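(* Let $K$ be a field, $\mathfrak m=(x_1,\dots,x_d)\subset K[x_1,\dots,x_d]$, $S=K[x_1,\dots,x_d]_{\mathfrak m}$, and $R=S/I$ for a proper ideal $I\subseteq S$. Let $P=S\otimes_KS$, viewed as an $S$-algebra via the left factor, let $d:S\to P$ be the map $d(g)=1\otimes g$, and write $\Delta^{[n]}=\big((x_1-\tilde x_1)^n,\dots,(x_d-\tilde x_d)^n\big)\subseteq P$, where $x_i=x_i\otimes1$ and $\tilde x_i=1\otimes x_i$. Then $R$ is $D_{R|K}$-simple if and only if for every $f\in S$ whose image in $R$ is nonzero there is some $n$ such that $$f\cdot\Big(\big(d(I)P+\Delta^{[n]}\big):_{P}IP\Big)\not\subseteq\mathfrak m^{[n]}P+d(\mathfrak m)P\quad\text{in }P.$$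
   Context: $\mathfrak m^{[n]}=(x_1^n,\dots,x_d^n)$, and $(J_1:_PJ_2)=\{g\in P : gJ_2\subseteq J_1\}$. $IP$ and $\mathfrak m^{[n]}P$ are extensions along the left factor; $d(I)P$, $d(\mathfrak m)P$ are extensions along the right factor; $f$ acts via the left factor. Differential operators: $D^0_{R|K}=\operatorname{Hom}_R(R,R)$, $D^n_{R|K}=\{\delta\in\operatorname{Hom}_K(R,R) : [\delta,r]\in D^{n-1}_{R|K}\ \forall r\in R\}$, $D_{R|K}=\bigcup_nD^n_{R|K}$. $R$ is $D_{R|K}$-simple if it is simple as a $D_{R|K}$-module, i.e. $0$ and $R$ are the only ideals of $R$ stable under $D_{R|K}$. *)

theory Defs
  imports
    "HOL-Library.Poly_Mapping"
    "HOL-Algebra.QuotRing"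
    "HOL-Algebra.Algebraic_Closure_Type"
begin

text \<open>Ideal-theoretic notions for the commutative rings that are given by types are those of
  \<^theory>\<open>HOL-Algebra.Ideal\<close>, for the ring structure \<^const>\<open>ring_of_type_algebra\<close>.\<close>

abbreviation ideal_gen :: "'a::comm_ring_1 set \<Rightarrow> 'a set"
  where "ideal_gen A \<equiv> Idl\<^bsub>ring_of_type_algebra\<^esub> A"

abbreviation ideal_sum :: "'a::comm_ring_1 set \<Rightarrow> 'a set \<Rightarrow> 'a set"
  where "ideal_sum A B \<equiv> A <+>\<^bsub>ring_of_type_algebra\<^esub> B"

definition ideal_colon :: "'a::comm_ring_1 set \<Rightarrow> 'a set \<Rightarrow> 'a set"
  where "ideal_colon J1 J2 = {g. \<forall>h\<in>J2. g * h \<in> J1}"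


section \<open>The polynomial ring and its localization at the origin\<close>

text \<open>Variables are indexed by \<open>'n\<close>; for a finite type this is the polynomial ring in
  \<open>d = CARD('n)\<close> variables.\<close>

type_synonym ('n, 'k) mpoly = "('n \<Rightarrow>\<^sub>0 nat) \<Rightarrow>\<^sub>0 'k"

definition mvar :: "'n \<Rightarrow> ('n, 'k::field) mpoly"
  where "mvar i = Poly_Mapping.single (Poly_Mapping.single i 1) 1"

definition mconst :: "'k::field \<Rightarrow> ('n, 'k) mpoly"
  where "mconst c = Poly_Mapping.single 0 c"

definition origin_ideal :: "('n, 'k::field) mpoly set"
  where "origin_ideal = ideal_gen (range mvar)"

lemma ideal_ring_of_type_iff:
  fixes J :: "'a::comm_ring_1 set"
  shows "ideal J ring_of_type_algebra \<longleftrightarrow>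
    0 \<in> J \<and> (\<forall>x\<in>J. \<forall>y\<in>J. x + y \<in> J) \<and> (\<forall>x\<in>J. \<forall>r. r * x \<in> J)"
proof -
  define A where "A = (ring_of_type_algebra :: 'a ring)"
  have A: "carrier A = UNIV" "(\<otimes>\<^bsub>A\<^esub>) = (*)" "(\<oplus>\<^bsub>A\<^esub>) = (+)" "\<zero>\<^bsub>A\<^esub> = 0"
    by (auto simp: A_def ring_of_type_algebra_def)
  interpret R: ring A unfolding A_def by (rule ring_from_type_algebra)
  have "ideal J A \<longleftrightarrow>
    0 \<in> J \<and> (\<forall>x\<in>J. \<forall>y\<in>J. x + y \<in> J) \<and> (\<forall>x\<in>J. \<forall>r. r * x \<in> J)"
  proof
    assume J: "ideal J A"
    interpret ideal J A by (rule J)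
    have "0 \<in> J"
      using additive_subgroup.zero_closed[OF is_additive_subgroup] by (simp only: A)
    moreover have "x + y \<in> J" if "x \<in> J" "y \<in> J" for x y
      using additive_subgroup.a_closed[OF is_additive_subgroup that] by (simp only: A)
    moreover have "r * x \<in> J" if "x \<in> J" for x r
      using I_l_closed[OF that, of r] by (simp only: A UNIV_I)
    ultimately show "0 \<in> J \<and> (\<forall>x\<in>J. \<forall>y\<in>J. x + y \<in> J) \<and> (\<forall>x\<in>J. \<forall>r. r * x \<in> J)"
      by blast
  next
    assume J: "0 \<in> J \<and> (\<forall>x\<in>J. \<forall>y\<in>J. x + y \<in> J) \<and> (\<forall>x\<in>J. \<forall>r. r * x \<in> J)"
    have minv: "m_inv (add_monoid A) x \<in> J" if "x \<in> J" for x
    proof -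
      have "\<ominus>\<^bsub>A\<^esub> x = - x"
        by (rule R.minus_equality) (simp_all add: A)
      moreover have "(- 1) * x \<in> J" using J that by blast
      ultimately show ?thesis by (simp add: a_inv_def)
    qed
    have "subgroup J (add_monoid A)"
      by (rule subgroup.intro) (use J minv in \<open>simp_all add: A\<close>)
    moreover have "x * a \<in> J" "a * x \<in> J" if "a \<in> J" for a x
      using J that by (simp_all add: mult.commute)
    ultimately show "ideal J A"
      by (intro idealI R.ring_axioms) (simp_all only: A)
  qed
  then show ?thesis by (simp only: A_def)
qed

lemma ideal_ideal_gen: "ideal (ideal_gen (A :: 'a::comm_ring_1 set)) ring_of_type_algebra"
proof -
  interpret R: ring "ring_of_type_algebra :: 'a ring" by (rule ring_from_type_algebra)
  show ?thesis by (rule R.genideal_ideal) (simp add: ring_of_type_algebra_def)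
qed

lemma ideal_gen_superset: "A \<subseteq> ideal_gen (A :: 'a::comm_ring_1 set)"
  unfolding genideal_def by auto

lemma ideal_gen_minimal:
  "ideal J ring_of_type_algebra \<Longrightarrow> A \<subseteq> J \<Longrightarrow> ideal_gen (A :: 'a::comm_ring_1 set) \<subseteq> J"
  unfolding genideal_def by auto

lemma lookup_mult_zero:
  fixes p q :: "('n, 'k::field) mpoly"
  shows "Poly_Mapping.lookup (p * q) 0 = Poly_Mapping.lookup p 0 * Poly_Mapping.lookup q 0"
proof -
  have eq: "(0 = l + m) \<longleftrightarrow> l = 0 \<and> m = 0" for l m :: "'n \<Rightarrow>\<^sub>0 nat"
    by (auto simp: poly_mapping_eq_iff fun_eq_iff lookup_add)
  have "Poly_Mapping.lookup (p * q) 0 = Sum_any (\<lambda>l. Poly_Mapping.lookup p l * Sum_any (\<lambda>m. Poly_Mapping.lookup q m when 0 = l + m))"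
    by (simp add: lookup_mult)
  also have "\<dots> = Sum_any (\<lambda>l. Poly_Mapping.lookup p l * Poly_Mapping.lookup q 0 when l = 0)"
  proof (rule Sum_any.cong)
    fix l :: "'n \<Rightarrow>\<^sub>0 nat"
    have "Sum_any (\<lambda>m. Poly_Mapping.lookup q m when 0 = l + m) = Sum_any (\<lambda>m. (Poly_Mapping.lookup q m when l = 0) when m = 0)"
      by (rule Sum_any.cong) (auto simp: eq when_def)
    then show "Poly_Mapping.lookup p l * Sum_any (\<lambda>m. Poly_Mapping.lookup q m when 0 = l + m) = (Poly_Mapping.lookup p l * Poly_Mapping.lookup q 0 when l = 0)"
      by (simp add: when_def)
  qed
  finally show ?thesis by simp
qed

lemma origin_ideal_iff: "p \<in> origin_ideal \<longleftrightarrow> Poly_Mapping.lookup p 0 = 0"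
  for p :: "('n, 'k::field) mpoly"
proof
  have "ideal {p :: ('n, 'k) mpoly. Poly_Mapping.lookup p 0 = 0} ring_of_type_algebra"
    by (auto simp: ideal_ring_of_type_iff lookup_add lookup_mult_zero)
  moreover have "(range mvar :: ('n, 'k) mpoly set) \<subseteq> {p. Poly_Mapping.lookup p 0 = 0}"
  proof -
    have "Poly_Mapping.single i (1::nat) \<noteq> 0" for i :: 'n
      by (metis lookup_single_eq lookup_zero zero_neq_one)
    then show ?thesis by (auto simp: mvar_def lookup_single when_def)
  qed
  ultimately show "p \<in> origin_ideal \<Longrightarrow> Poly_Mapping.lookup p 0 = 0"
    unfolding origin_ideal_def using ideal_gen_minimal by blast
next
  have id: "0 \<in> (origin_ideal :: ('n, 'k) mpoly set)"
    "\<And>x y :: ('n, 'k) mpoly. x \<in> origin_ideal \<Longrightarrow> y \<in> origin_ideal \<Longrightarrow> x + y \<in> origin_ideal"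
    "\<And>x r :: ('n, 'k) mpoly. x \<in> origin_ideal \<Longrightarrow> r * x \<in> origin_ideal"
    using ideal_ideal_gen[of "range mvar :: ('n, 'k) mpoly set"]
    unfolding ideal_ring_of_type_iff origin_ideal_def by blast+
  have var: "mvar i \<in> (origin_ideal :: ('n, 'k) mpoly set)" for i
    using ideal_gen_superset[of "range mvar :: ('n, 'k) mpoly set"] by (auto simp: origin_ideal_def)
  have mono: "Poly_Mapping.single m c \<in> (origin_ideal :: ('n, 'k) mpoly set)" if "m \<noteq> 0" for m c
  proof -
    from that obtain i where i: "Poly_Mapping.lookup m i \<noteq> 0"
      by (auto simp: poly_mapping_eq_iff fun_eq_iff)
    have "m = (m - Poly_Mapping.single i 1) + Poly_Mapping.single i 1"
      using i by (auto simp: poly_mapping_eq_iff fun_eq_iff lookup_add lookup_minus lookup_single when_def)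
    then have "Poly_Mapping.single m c =
        Poly_Mapping.single (m - Poly_Mapping.single i 1) c * mvar i"
      by (simp add: mvar_def mult_single)
    then show ?thesis using id(3) var by metis
  qed
  have sum_in: "sum f A \<in> (origin_ideal :: ('n, 'k) mpoly set)"
    if "finite A" "\<And>m. m \<in> A \<Longrightarrow> f m \<in> origin_ideal" for f :: "('n \<Rightarrow>\<^sub>0 nat) \<Rightarrow> ('n, 'k) mpoly" and A
    using that by (induction A) (auto simp: id)
  assume p: "Poly_Mapping.lookup p 0 = 0"
  have "(\<Sum>m\<in>Poly_Mapping.keys p. Poly_Mapping.single m (Poly_Mapping.lookup p m)) \<in> origin_ideal"
  proof (rule sum_in[OF finite_keys])
    fix m assume "m \<in> Poly_Mapping.keys p"
    then have "m \<noteq> 0" using p by (metis in_keys_iff)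
    then show "Poly_Mapping.single m (Poly_Mapping.lookup p m) \<in> origin_ideal" by (rule mono)
  qed
  moreover have "(\<Sum>m\<in>Poly_Mapping.keys p. Poly_Mapping.single m (Poly_Mapping.lookup p m)) = p"
    by (rule poly_mapping_eqI)
       (simp add: lookup_sum lookup_single when_def in_keys_iff)
  ultimately show "p \<in> origin_ideal" by simp
qed

lemma one_notin_origin_ideal: "1 \<notin> (origin_ideal :: ('n, 'k::field) mpoly set)"
  by (simp add: origin_ideal_iff lookup_one)

lemma mult_notin_origin_ideal:
  "s \<notin> origin_ideal \<Longrightarrow> t \<notin> origin_ideal \<Longrightarrow> s * t \<notin> (origin_ideal :: ('n, 'k::field) mpoly set)"
  by (simp add: origin_ideal_iff lookup_mult_zero)

text \<open>A pair \<open>(a, s)\<close> with \<open>s\<close> outside the ideal of the origin stands for the fraction \<open>a / s\<close>.\<close>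

definition frac_rel :: "('n, 'k::field) mpoly \<times> ('n, 'k) mpoly \<Rightarrow> ('n, 'k) mpoly \<times> ('n, 'k) mpoly \<Rightarrow> bool"
  where "frac_rel x y \<longleftrightarrow> snd x \<notin> origin_ideal \<and> snd y \<notin> origin_ideal \<and>
    (\<exists>u. u \<notin> origin_ideal \<and> u * (fst x * snd y - fst y * snd x) = 0)"

lemma frac_relI:
  assumes "snd x \<notin> origin_ideal" "snd y \<notin> origin_ideal" "fst x * snd y = fst y * snd x"
  shows "frac_rel x y"
  unfolding frac_rel_def using assms
  by (intro conjI exI[of _ 1] one_notin_origin_ideal) simp_all

lemma frac_rel_refl_iff: "frac_rel x x \<longleftrightarrow> snd x \<notin> origin_ideal"
  using frac_relI[of x x] by (auto simp: frac_rel_def)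

lemma part_equivp_frac_rel: "part_equivp (frac_rel :: ('n, 'k::field) mpoly \<times> _ \<Rightarrow> _)"
proof (rule part_equivpI)
  show "\<exists>x. frac_rel x (x :: ('n, 'k) mpoly \<times> _)"
    by (rule exI[of _ "(0, 1)"]) (rule frac_relI; simp add: one_notin_origin_ideal)
  show "symp (frac_rel :: ('n, 'k) mpoly \<times> _ \<Rightarrow> _)"
  proof (rule sympI)
    fix x y :: "('n, 'k) mpoly \<times> ('n, 'k) mpoly"
    assume "frac_rel x y"
    then obtain u where u: "u \<notin> origin_ideal" "u * (fst x * snd y - fst y * snd x) = 0"
      and s: "snd x \<notin> origin_ideal" "snd y \<notin> origin_ideal"
      by (auto simp: frac_rel_def)
    have "u * (fst y * snd x - fst x * snd y) = - (u * (fst x * snd y - fst y * snd x))"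
      by (simp add: algebra_simps)
    also have "\<dots> = 0" by (simp only: u minus_zero)
    finally show "frac_rel y x"
      unfolding frac_rel_def using u(1) s by blast
  qed
  show "transp (frac_rel :: ('n, 'k) mpoly \<times> _ \<Rightarrow> _)"
  proof (rule transpI)
    fix x y z :: "('n, 'k) mpoly \<times> ('n, 'k) mpoly"
    assume "frac_rel x y" "frac_rel y z"
    then obtain u v where uv: "u \<notin> origin_ideal" "u * (fst x * snd y - fst y * snd x) = 0"
      "v \<notin> origin_ideal" "v * (fst y * snd z - fst z * snd y) = 0"
      and s: "snd x \<notin> origin_ideal" "snd y \<notin> origin_ideal" "snd z \<notin> origin_ideal"
      by (auto simp: frac_rel_def)
    have "(u * v * snd y) * (fst x * snd z - fst z * snd x) =
        v * snd z * (u * (fst x * snd y - fst y * snd x)) +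
        u * snd x * (v * (fst y * snd z - fst z * snd y))"
      by (simp add: algebra_simps)
    also have "\<dots> = 0" using uv by simp
    finally show "frac_rel x z"
      unfolding frac_rel_def using uv(1,3) s
      by (intro conjI exI[of _ "u * v * snd y"] mult_notin_origin_ideal)
  qed
qed

quotient_type (overloaded) ('n, 'k) locpoly = "('n, 'k::field) mpoly \<times> ('n, 'k) mpoly" / partial: frac_rel
  by (rule part_equivp_frac_rel)

instantiation locpoly :: (type, field) comm_ring_1
begin

lift_definition zero_locpoly :: "('n, 'k::field) locpoly" is "(0, 1)"
  by (rule frac_relI; simp add: one_notin_origin_ideal)

lift_definition one_locpoly :: "('n, 'k::field) locpoly" is "(1, 1)"
  by (rule frac_relI; simp add: one_notin_origin_ideal)

lift_definition plus_locpoly :: "('n, 'k::field) locpoly \<Rightarrow> ('n, 'k) locpoly \<Rightarrow> ('n, 'k) locpoly"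
  is "\<lambda>x y. (fst x * snd y + fst y * snd x, snd x * snd y)"
proof -
  fix x x' y y' :: "('n, 'k::field) mpoly \<times> ('n, 'k) mpoly"
  assume "frac_rel x x'" "frac_rel y y'"
  then obtain u v where uv: "u \<notin> origin_ideal" "u * (fst x * snd x' - fst x' * snd x) = 0"
      "v \<notin> origin_ideal" "v * (fst y * snd y' - fst y' * snd y) = 0"
      and s: "snd x \<notin> origin_ideal" "snd x' \<notin> origin_ideal" "snd y \<notin> origin_ideal" "snd y' \<notin> origin_ideal"
      by (auto simp: frac_rel_def)
  have "(u * v) * ((fst x * snd y + fst y * snd x) * (snd x' * snd y') -
      (fst x' * snd y' + fst y' * snd x') * (snd x * snd y)) =
      v * snd y * snd y' * (u * (fst x * snd x' - fst x' * snd x)) +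
      u * snd x * snd x' * (v * (fst y * snd y' - fst y' * snd y))"
    by (simp add: algebra_simps)
  also have "\<dots> = 0" using uv by simp
  finally show "frac_rel (fst x * snd y + fst y * snd x, snd x * snd y)
      (fst x' * snd y' + fst y' * snd x', snd x' * snd y')"
    unfolding frac_rel_def fst_conv snd_conv using uv(1,3) s
    by (intro conjI exI[of _ "u * v"] mult_notin_origin_ideal)
qed

lift_definition times_locpoly :: "('n, 'k::field) locpoly \<Rightarrow> ('n, 'k) locpoly \<Rightarrow> ('n, 'k) locpoly"
  is "\<lambda>x y. (fst x * fst y, snd x * snd y)"
proof -
  fix x x' y y' :: "('n, 'k::field) mpoly \<times> ('n, 'k) mpoly"
  assume "frac_rel x x'" "frac_rel y y'"
  then obtain u v where uv: "u \<notin> origin_ideal" "u * (fst x * snd x' - fst x' * snd x) = 0"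
      "v \<notin> origin_ideal" "v * (fst y * snd y' - fst y' * snd y) = 0"
      and s: "snd x \<notin> origin_ideal" "snd x' \<notin> origin_ideal" "snd y \<notin> origin_ideal" "snd y' \<notin> origin_ideal"
      by (auto simp: frac_rel_def)
  have "(u * v) * ((fst x * fst y) * (snd x' * snd y') - (fst x' * fst y') * (snd x * snd y)) =
      v * fst y * snd y' * (u * (fst x * snd x' - fst x' * snd x)) +
      u * fst x' * snd x * (v * (fst y * snd y' - fst y' * snd y))"
    by (simp add: algebra_simps)
  also have "\<dots> = 0" using uv by simp
  finally show "frac_rel (fst x * fst y, snd x * snd y) (fst x' * fst y', snd x' * snd y')"
    unfolding frac_rel_def fst_conv snd_conv using uv(1,3) s
    by (intro conjI exI[of _ "u * v"] mult_notin_origin_ideal)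
qed

lift_definition uminus_locpoly :: "('n, 'k::field) locpoly \<Rightarrow> ('n, 'k) locpoly"
  is "\<lambda>x. (- fst x, snd x)"
proof -
  fix x y :: "('n, 'k::field) mpoly \<times> ('n, 'k) mpoly"
  assume "frac_rel x y"
  then obtain u where u: "u \<notin> origin_ideal" "u * (fst x * snd y - fst y * snd x) = 0"
    and s: "snd x \<notin> origin_ideal" "snd y \<notin> origin_ideal"
    by (auto simp: frac_rel_def)
  have "u * (- fst x * snd y - - fst y * snd x) = - (u * (fst x * snd y - fst y * snd x))"
    by (simp add: algebra_simps)
  also have "\<dots> = 0" by (simp only: u minus_zero)
  finally show "frac_rel (- fst x, snd x) (- fst y, snd y)"
    unfolding frac_rel_def fst_conv snd_conv using u(1) s by blast
qed

definition minus_locpoly :: "('n, 'k::field) locpoly \<Rightarrow> ('n, 'k) locpoly \<Rightarrow> ('n, 'k) locpoly"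
  where "minus_locpoly x y = x + - y"

instance
proof
  fix a b c :: "('n, 'k::field) locpoly"
  show "a + b + c = a + (b + c)"
    by transfer (rule frac_relI; simp add: frac_rel_refl_iff mult_notin_origin_ideal one_notin_origin_ideal algebra_simps)
  show "a + b = b + a"
    by transfer (rule frac_relI; simp add: frac_rel_refl_iff mult_notin_origin_ideal one_notin_origin_ideal algebra_simps)
  show "0 + a = a"
    by transfer (rule frac_relI; simp add: frac_rel_refl_iff mult_notin_origin_ideal one_notin_origin_ideal algebra_simps)
  show "- a + a = 0"
    by transfer (rule frac_relI; simp add: frac_rel_refl_iff mult_notin_origin_ideal one_notin_origin_ideal algebra_simps)
  show "a - b = a + - b" by (rule minus_locpoly_def)
  show "a * b * c = a * (b * c)"
    by transfer (rule frac_relI; simp add: frac_rel_refl_iff mult_notin_origin_ideal one_notin_origin_ideal algebra_simps)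
  show "a * b = b * a"
    by transfer (rule frac_relI; simp add: frac_rel_refl_iff mult_notin_origin_ideal one_notin_origin_ideal algebra_simps)
  show "1 * a = a"
    by transfer (rule frac_relI; simp add: frac_rel_refl_iff mult_notin_origin_ideal one_notin_origin_ideal algebra_simps)
  show "(a + b) * c = a * c + b * c"
    by transfer (rule frac_relI; simp add: frac_rel_refl_iff mult_notin_origin_ideal one_notin_origin_ideal algebra_simps)
  show "(0 :: ('n, 'k) locpoly) \<noteq> 1"
  proof transfer
    have "u = 0" if "u * (0 * 1 - 1 * 1) = 0" for u :: "('n, 'k) mpoly"
      using that by simp
    then show "\<not> frac_rel (0, 1) (1, 1 :: ('n, 'k) mpoly)"
      unfolding frac_rel_def fst_conv snd_conv by (metis lookup_zero origin_ideal_iff)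
  qed
qed

end

definition loc :: "('n, 'k::field) mpoly \<Rightarrow> ('n, 'k) locpoly"
  where "loc p = abs_locpoly (p, 1)"

definition loc_var :: "'n \<Rightarrow> ('n, 'k::field) locpoly"
  where "loc_var i = loc (mvar i)"

definition loc_const :: "'k::field \<Rightarrow> ('n, 'k) locpoly"
  where "loc_const c = loc (mconst c)"

definition max_ideal :: "('n, 'k::field) locpoly set"
  where "max_ideal = ideal_gen (loc ` origin_ideal)"

definition frob_ideal :: "nat \<Rightarrow> ('n, 'k::field) locpoly set"
  where "frob_ideal n = ideal_gen (range (\<lambda>i. loc_var i ^ n))"


section \<open>The tensor square over the ground field\<close>

text \<open>The subgroup of bilinearity relations in the free abelian group on \<open>'a \<times> 'b\<close>, whose
  quotient is the tensor product over \<open>'k\<close> of the algebras with structure maps \<open>\<alpha>\<close> and \<open>\<beta>\<close>.\<close>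

inductive_set tensor_rels ::
    "('k \<Rightarrow> 'a::comm_ring_1) \<Rightarrow> ('k \<Rightarrow> 'b::comm_ring_1) \<Rightarrow> ('a \<times> 'b \<Rightarrow>\<^sub>0 int) set"
  for \<alpha> \<beta> where
  add_left: "frag_of (a + a', b) - frag_of (a, b) - frag_of (a', b) \<in> tensor_rels \<alpha> \<beta>"
| add_right: "frag_of (a, b + b') - frag_of (a, b) - frag_of (a, b') \<in> tensor_rels \<alpha> \<beta>"
| balanced: "frag_of (\<alpha> c * a, b) - frag_of (a, \<beta> c * b) \<in> tensor_rels \<alpha> \<beta>"
| zero: "0 \<in> tensor_rels \<alpha> \<beta>"
| diff: "x \<in> tensor_rels \<alpha> \<beta> \<Longrightarrow> y \<in> tensor_rels \<alpha> \<beta> \<Longrightarrow> x - y \<in> tensor_rels \<alpha> \<beta>"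

definition tensor_times ::
    "('a::comm_ring_1 \<times> 'b::comm_ring_1 \<Rightarrow>\<^sub>0 int) \<Rightarrow> ('a \<times> 'b \<Rightarrow>\<^sub>0 int) \<Rightarrow> ('a \<times> 'b \<Rightarrow>\<^sub>0 int)"
  where "tensor_times x y =
    frag_extend (\<lambda>(a, b). frag_extend (\<lambda>(a', b'). frag_of (a * a', b * b')) y) x"

lemma tensor_rels_minus: "x \<in> tensor_rels \<alpha> \<beta> \<Longrightarrow> - x \<in> tensor_rels \<alpha> \<beta>"
  using tensor_rels.diff[OF tensor_rels.zero] by fastforce

lemma tensor_rels_add: "x \<in> tensor_rels \<alpha> \<beta> \<Longrightarrow> y \<in> tensor_rels \<alpha> \<beta> \<Longrightarrow> x + y \<in> tensor_rels \<alpha> \<beta>"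
  using tensor_rels.diff[OF _ tensor_rels_minus, of x \<alpha> \<beta> y] by simp

lemma tensor_times_of: "tensor_times (frag_of (a, b)) (frag_of (a', b')) = frag_of (a * a', b * b')"
  by (simp add: tensor_times_def)

lemma tensor_times_of_left:
  "tensor_times (frag_of (a, b)) y = frag_extend (\<lambda>(a', b'). frag_of (a * a', b * b')) y"
  by (simp add: tensor_times_def)

lemma tensor_times_zero: "tensor_times 0 y = 0" "tensor_times x 0 = 0"
  by (auto simp: tensor_times_def intro!: frag_extend_eq_0)

lemma tensor_times_diff_left: "tensor_times (x - x') y = tensor_times x y - tensor_times x' y"
  by (simp add: tensor_times_def frag_extend_diff)

lemma tensor_times_diff_right: "tensor_times x (y - y') = tensor_times x y - tensor_times x y'"
proof (induction x rule: frag_induction[OF subset_UNIV])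
  case 1 show ?case by (simp add: tensor_times_zero)
next
  case (2 p) show ?case by (cases p) (simp add: tensor_times_of_left frag_extend_diff)
next
  case (3 a b) then show ?case by (simp add: tensor_times_diff_left)
qed

lemma tensor_times_add_left: "tensor_times (x + x') y = tensor_times x y + tensor_times x' y"
  by (simp add: tensor_times_def frag_extend_add)

lemma tensor_times_commute: "tensor_times x y = tensor_times y x"
proof (induction x rule: frag_induction[OF subset_UNIV])
  case 1 show ?case by (simp add: tensor_times_zero)
next
  case (2 p) show ?case
  proof (induction y rule: frag_induction[OF subset_UNIV])
    case 1 show ?case by (simp add: tensor_times_zero)
  next
    case (2 q) show ?case by (cases p; cases q) (simp add: tensor_times_of mult.commute)
  next
    case (3 a b) then show ?case by (simp add: tensor_times_diff_left tensor_times_diff_right)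
  qed
next
  case (3 a b) then show ?case by (simp add: tensor_times_diff_left tensor_times_diff_right)
qed

lemma tensor_times_assoc: "tensor_times (tensor_times x y) z = tensor_times x (tensor_times y z)"
proof (induction x rule: frag_induction[OF subset_UNIV])
  case 1 show ?case by (simp add: tensor_times_zero)
next
  case (2 p) show ?case
  proof (induction y rule: frag_induction[OF subset_UNIV])
    case 1 show ?case by (simp add: tensor_times_zero)
  next
    case (2 q) show ?case
    proof (induction z rule: frag_induction[OF subset_UNIV])
      case 1 show ?case by (simp add: tensor_times_zero)
    next
      case (2 r) show ?case by (cases p; cases q; cases r) (simp add: tensor_times_of mult.assoc)
    next
      case (3 a b) then show ?case by (simp add: tensor_times_diff_right)
    qed
  next
    case (3 a b) then show ?case by (simp add: tensor_times_diff_left tensor_times_diff_right)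
  qed
next
  case (3 a b) then show ?case by (simp add: tensor_times_diff_left)
qed

lemma tensor_times_one: "tensor_times (frag_of (1, 1)) x = x"
proof -
  have "(\<lambda>(a' :: 'a, b' :: 'b). frag_of (1 * a', 1 * b')) = frag_of" by auto
  then show ?thesis unfolding tensor_times_of_left using frag_expansion[of x] by simp
qed

lemma tensor_rels_times:
  assumes "x \<in> tensor_rels \<alpha> \<beta>"
  shows "tensor_times x y \<in> tensor_rels \<alpha> \<beta>"
  using assms
proof (induction x)
  case (add_left a a' b) show ?case
  proof (induction y rule: frag_induction[OF subset_UNIV])
    case (2 q) show ?case
      by (cases q) (simp add: tensor_times_diff_left tensor_times_of distrib_right tensor_rels.add_left)
  qed (auto simp: tensor_times_zero tensor_times_diff_right intro: tensor_rels.zero tensor_rels.diff)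
next
  case (add_right a b b') show ?case
  proof (induction y rule: frag_induction[OF subset_UNIV])
    case (2 q) show ?case
      by (cases q) (simp add: tensor_times_diff_left tensor_times_of distrib_right tensor_rels.add_right)
  qed (auto simp: tensor_times_zero tensor_times_diff_right intro: tensor_rels.zero tensor_rels.diff)
next
  case (balanced c a b) show ?case
  proof (induction y rule: frag_induction[OF subset_UNIV])
    case (2 q) show ?case
      by (cases q) (simp add: tensor_times_diff_left tensor_times_of mult.assoc tensor_rels.balanced)
  qed (auto simp: tensor_times_zero tensor_times_diff_right intro: tensor_rels.zero tensor_rels.diff)
qed (auto simp: tensor_times_zero tensor_times_diff_left intro: tensor_rels.zero tensor_rels.diff)

text \<open>The following type is \<open>P = S \<otimes>\<^sub>K S\<close>, where \<open>S\<close> is the type \<^typ>\<open>('n, 'k) locpoly\<close>.\<close>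

quotient_type (overloaded) ('n, 'k) locpoly2 =
    "('n, 'k::field) locpoly \<times> ('n, 'k) locpoly \<Rightarrow>\<^sub>0 int" /
    "\<lambda>x y. x - y \<in> tensor_rels loc_const loc_const"
proof (rule equivpI)
  show "reflp (\<lambda>x y :: ('n, 'k) locpoly \<times> ('n, 'k) locpoly \<Rightarrow>\<^sub>0 int. x - y \<in> tensor_rels loc_const loc_const)"
    by (rule reflpI) (simp add: tensor_rels.zero)
  show "symp (\<lambda>x y :: ('n, 'k) locpoly \<times> ('n, 'k) locpoly \<Rightarrow>\<^sub>0 int. x - y \<in> tensor_rels loc_const loc_const)"
  proof (rule sympI)
    fix x y :: "('n, 'k) locpoly \<times> ('n, 'k) locpoly \<Rightarrow>\<^sub>0 int"
    assume "x - y \<in> tensor_rels loc_const loc_const"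
    from tensor_rels_minus[OF this] show "y - x \<in> tensor_rels loc_const loc_const"
      by (simp only: minus_diff_eq)
  qed
  show "transp (\<lambda>x y :: ('n, 'k) locpoly \<times> ('n, 'k) locpoly \<Rightarrow>\<^sub>0 int. x - y \<in> tensor_rels loc_const loc_const)"
  proof (rule transpI)
    fix x y z :: "('n, 'k) locpoly \<times> ('n, 'k) locpoly \<Rightarrow>\<^sub>0 int"
    assume "x - y \<in> tensor_rels loc_const loc_const" "y - z \<in> tensor_rels loc_const loc_const"
    from tensor_rels_add[OF this] show "x - z \<in> tensor_rels loc_const loc_const"
      by simp
  qed
qed

text \<open>Evaluation at the origin, used only to see that \<open>0 \<noteq> 1\<close> in \<open>P\<close>.\<close>

lift_definition loc_eval :: "('n, 'k::field) locpoly \<Rightarrow> 'k"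
  is "\<lambda>x. Poly_Mapping.lookup (fst x) 0 / Poly_Mapping.lookup (snd x) 0"
proof -
  fix x y :: "('n, 'k::field) mpoly \<times> ('n, 'k) mpoly"
  assume "frac_rel x y"
  then obtain u where u: "Poly_Mapping.lookup u 0 \<noteq> 0" "u * (fst x * snd y - fst y * snd x) = 0"
    and s: "Poly_Mapping.lookup (snd x) 0 \<noteq> 0" "Poly_Mapping.lookup (snd y) 0 \<noteq> 0"
    by (auto simp: frac_rel_def origin_ideal_iff)
  have "Poly_Mapping.lookup u 0 * (Poly_Mapping.lookup (fst x) 0 * Poly_Mapping.lookup (snd y) 0 - Poly_Mapping.lookup (fst y) 0 * Poly_Mapping.lookup (snd x) 0) = 0"
    using arg_cong[OF u(2), of "\<lambda>p. Poly_Mapping.lookup p 0"] by (simp add: lookup_mult_zero lookup_minus)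
  then show "Poly_Mapping.lookup (fst x) 0 / Poly_Mapping.lookup (snd x) 0 = Poly_Mapping.lookup (fst y) 0 / Poly_Mapping.lookup (snd y) 0"
    using u(1) s by (simp add: frac_eq_eq)
qed

lemma loc_eval_simps:
  "loc_eval (a + b) = loc_eval a + loc_eval b"
  "loc_eval (a * b) = loc_eval a * loc_eval b"
  "loc_eval 1 = 1"
proof -
  show "loc_eval (a + b) = loc_eval a + loc_eval b"
    by transfer (simp add: frac_rel_refl_iff origin_ideal_iff lookup_add lookup_mult_zero add_frac_eq)
  show "loc_eval (a * b) = loc_eval a * loc_eval b"
    by transfer (simp add: lookup_mult_zero)
  show "loc_eval 1 = 1"
    by transfer (simp add: lookup_one)
qed

lemma one_notin_tensor_rels:
  "frag_of (1, 1) \<notin> tensor_rels (loc_const :: 'k \<Rightarrow> ('n, 'k::field) locpoly) (loc_const :: 'k \<Rightarrow> ('n, 'k) locpoly)"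
proof
  define \<phi> :: "(('n, 'k) locpoly \<times> ('n, 'k) locpoly \<Rightarrow>\<^sub>0 int) \<Rightarrow> 'k"
    where "\<phi> x = Sum_any (\<lambda>p. of_int (Poly_Mapping.lookup x p) * (loc_eval (fst p) * loc_eval (snd p)))" for x
  have fin: "finite {p. of_int (Poly_Mapping.lookup x p) * h p \<noteq> (0 :: 'k)}"
    for x :: "('n, 'k) locpoly \<times> ('n, 'k) locpoly \<Rightarrow>\<^sub>0 int" and h
    by (rule finite_subset[OF _ finite_keys[of x]]) (auto simp: in_keys_iff)
  have add: "\<phi> (x + y) = \<phi> x + \<phi> y" for x y
    unfolding \<phi>_def by (simp add: lookup_add distrib_right Sum_any.distrib[OF fin fin])
  have diff: "\<phi> (x - y) = \<phi> x - \<phi> y" for x y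
    using add[of "x - y" y] by simp
  have of: "\<phi> (frag_of (a, b)) = loc_eval a * loc_eval b" for a b
  proof -
    have "\<phi> (frag_of (a, b)) = Sum_any (\<lambda>p. loc_eval a * loc_eval b when p = (a, b))"
      unfolding \<phi>_def by (rule Sum_any.cong) (auto simp: when_def)
    then show ?thesis by simp
  qed
  have zero: "\<phi> 0 = 0" by (simp add: \<phi>_def)
  have "\<phi> x = 0" if "x \<in> tensor_rels (loc_const :: 'k \<Rightarrow> ('n, 'k) locpoly) (loc_const :: 'k \<Rightarrow> ('n, 'k) locpoly)" for x
    using that by induction (simp_all add: diff of zero loc_eval_simps distrib_left distrib_right mult_ac)
  moreover assume "frag_of (1, 1) \<in> tensor_rels (loc_const :: 'k \<Rightarrow> ('n, 'k) locpoly) (loc_const :: 'k \<Rightarrow> ('n, 'k) locpoly)"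
  ultimately show False using of[of 1 1] by (simp add: loc_eval_simps)
qed

instantiation locpoly2 :: (type, field) comm_ring_1
begin

lift_definition zero_locpoly2 :: "('n, 'k::field) locpoly2" is 0 .

lift_definition one_locpoly2 :: "('n, 'k::field) locpoly2" is "frag_of (1, 1)" .

lift_definition plus_locpoly2 :: "('n, 'k::field) locpoly2 \<Rightarrow> ('n, 'k) locpoly2 \<Rightarrow> ('n, 'k) locpoly2"
  is "(+)"
  by (simp only: add_diff_add tensor_rels_add)

lift_definition uminus_locpoly2 :: "('n, 'k::field) locpoly2 \<Rightarrow> ('n, 'k) locpoly2"
  is uminus
  by (simp only: minus_diff_minus tensor_rels_minus)

lift_definition minus_locpoly2 :: "('n, 'k::field) locpoly2 \<Rightarrow> ('n, 'k) locpoly2 \<Rightarrow> ('n, 'k) locpoly2"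
  is "(-)"
proof -
  fix x x' y y' :: "('n, 'k::field) locpoly \<times> ('n, 'k) locpoly \<Rightarrow>\<^sub>0 int"
  assume *: "x - x' \<in> tensor_rels loc_const loc_const" "y - y' \<in> tensor_rels loc_const loc_const"
  have "(x - y) - (x' - y') = (x - x') - (y - y')" by simp
  then show "(x - y) - (x' - y') \<in> tensor_rels loc_const loc_const"
    using * by (simp only: tensor_rels.diff)
qed

lift_definition times_locpoly2 :: "('n, 'k::field) locpoly2 \<Rightarrow> ('n, 'k) locpoly2 \<Rightarrow> ('n, 'k) locpoly2"
  is tensor_times
proof -
  fix x x' y y' :: "('n, 'k::field) locpoly \<times> ('n, 'k) locpoly \<Rightarrow>\<^sub>0 int"
  assume *: "x - x' \<in> tensor_rels loc_const loc_const" "y - y' \<in> tensor_rels loc_const loc_const"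
  have "tensor_times x y - tensor_times x' y' = tensor_times (x - x') y + tensor_times (y - y') x'"
    unfolding tensor_times_commute[of "y - y'" x']
    by (simp add: tensor_times_diff_left tensor_times_diff_right)
  then show "tensor_times x y - tensor_times x' y' \<in> tensor_rels loc_const loc_const"
    using * by (simp add: tensor_rels_add tensor_rels_times)
qed

instance
proof
  fix a b c :: "('n, 'k::field) locpoly2"
  show "a + b + c = a + (b + c)" by transfer (simp add: add.assoc tensor_rels.zero)
  show "a + b = b + a" by transfer (simp add: add.commute tensor_rels.zero)
  show "0 + a = a" by transfer (simp add: tensor_rels.zero)
  show "- a + a = 0" by transfer (simp add: tensor_rels.zero)
  show "a - b = a + - b" by transfer (simp add: tensor_rels.zero)
  show "a * b * c = a * (b * c)" by transfer (simp add: tensor_times_assoc tensor_rels.zero)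
  show "a * b = b * a" by transfer (simp add: tensor_times_commute tensor_rels.zero)
  show "1 * a = a" by transfer (simp add: tensor_times_one tensor_rels.zero)
  show "(a + b) * c = a * c + b * c" by transfer (simp add: tensor_times_add_left tensor_rels.zero)
  show "(0 :: ('n, 'k) locpoly2) \<noteq> 1"
    by transfer (use one_notin_tensor_rels tensor_rels_minus in fastforce)
qed

end

definition tensor :: "('n, 'k::field) locpoly \<Rightarrow> ('n, 'k) locpoly \<Rightarrow> ('n, 'k) locpoly2"
  where "tensor a b = abs_locpoly2 (frag_of (a, b))"

definition left_incl :: "('n, 'k::field) locpoly \<Rightarrow> ('n, 'k) locpoly2"
  where "left_incl g = tensor g 1"

definition right_incl :: "('n, 'k::field) locpoly \<Rightarrow> ('n, 'k) locpoly2"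
  where "right_incl g = tensor 1 g"

definition ext_left :: "('n, 'k::field) locpoly set \<Rightarrow> ('n, 'k) locpoly2 set"
  where "ext_left J = ideal_gen (left_incl ` J)"

definition ext_right :: "('n, 'k::field) locpoly set \<Rightarrow> ('n, 'k) locpoly2 set"
  where "ext_right J = ideal_gen (right_incl ` J)"

definition diag_frob :: "nat \<Rightarrow> ('n, 'k::field) locpoly2 set"
  where "diag_frob n = ideal_gen (range (\<lambda>i. (left_incl (loc_var i) - right_incl (loc_var i)) ^ n))"


section \<open>Differential operators\<close>

text \<open>Endomorphisms of the additive group of \<open>R\<close> that commute with multiplication by the elements
  of \<open>C \<subseteq> carrier R\<close>. The case \<open>C = carrier R\<close> gives \<open>Hom\<^sub>R(R, R)\<close>; when \<open>C\<close> is the image of \<open>K\<close>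
  in \<open>R\<close>, one gets \<open>Hom\<^sub>K(R, R)\<close>. As usual for carrier-based structures, maps are extensional, so
  that equality is equality on \<open>carrier R\<close>.\<close>

definition hom_over :: "'a set \<Rightarrow> ('a, 'b) ring_scheme \<Rightarrow> ('a \<Rightarrow> 'a) set"
  where "hom_over C R = {\<delta> \<in> carrier R \<rightarrow>\<^sub>E carrier R.
    (\<forall>x\<in>carrier R. \<forall>y\<in>carrier R. \<delta> (x \<oplus>\<^bsub>R\<^esub> y) = \<delta> x \<oplus>\<^bsub>R\<^esub> \<delta> y) \<and>
    (\<forall>c\<in>C. \<forall>x\<in>carrier R. \<delta> (c \<otimes>\<^bsub>R\<^esub> x) = c \<otimes>\<^bsub>R\<^esub> \<delta> x)}"

definition commutator :: "('a, 'b) ring_scheme \<Rightarrow> ('a \<Rightarrow> 'a) \<Rightarrow> 'a \<Rightarrow> 'a \<Rightarrow> 'a"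
  where "commutator R \<delta> r = (\<lambda>x\<in>carrier R. \<delta> (r \<otimes>\<^bsub>R\<^esub> x) \<ominus>\<^bsub>R\<^esub> r \<otimes>\<^bsub>R\<^esub> \<delta> x)"

primrec diff_ops_order :: "'a set \<Rightarrow> ('a, 'b) ring_scheme \<Rightarrow> nat \<Rightarrow> ('a \<Rightarrow> 'a) set" where
  "diff_ops_order C R 0 = hom_over (carrier R) R"
| "diff_ops_order C R (Suc n) =
    {\<delta> \<in> hom_over C R. \<forall>r\<in>carrier R. commutator R \<delta> r \<in> diff_ops_order C R n}"

definition diff_ops :: "'a set \<Rightarrow> ('a, 'b) ring_scheme \<Rightarrow> ('a \<Rightarrow> 'a) set"
  where "diff_ops C R = (\<Union>n. diff_ops_order C R n)"

definition D_simple :: "'a set \<Rightarrow> ('a, 'b) ring_scheme \<Rightarrow> bool"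
  where "D_simple C R \<longleftrightarrow> carrier R \<noteq> {\<zero>\<^bsub>R\<^esub>} \<and>
    (\<forall>J. ideal J R \<and> (\<forall>\<delta>\<in>diff_ops C R. \<delta> ` J \<subseteq> J) \<longrightarrow> J = {\<zero>\<^bsub>R\<^esub>} \<or> J = carrier R)"


section \<open>Quotients of the local ring\<close>

abbreviation loc_ring :: "('n, 'k::field) locpoly ring"
  where "loc_ring \<equiv> ring_of_type_algebra"

definition quot_scalars :: "('n, 'k::field) locpoly set \<Rightarrow> ('n, 'k) locpoly set set"
  where "quot_scalars I = range (\<lambda>c. I +>\<^bsub>loc_ring\<^esub> loc_const c)"

end

theory Submission
  imports Defs
begin

text \<open>The quotient of \<open>P\<close> by \<open>\<Delta>\<^bsup>[n]\<^esup>\<close> is free over the right factor on the monomials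
  \<open>y\<^sup>a\<close> with \<open>y\<^sub>i = x\<^sub>i \<otimes> 1 - 1 \<otimes> x\<^sub>i\<close> and all exponents below \<open>n\<close>, and the coefficient \<open>\<Phi>\<close>
  of the top monomial is a perfect pairing: \<open>\<Phi>(w P) \<subseteq> J\<close> holds exactly when
  \<open>w \<in> d(J)P + \<Delta>\<^bsup>[n]\<^esup>\<close>. A differential operator on \<open>R\<close> extends to a functional on \<open>P\<close> modulo \<open>I\<close>
  that kills \<open>\<Delta>\<^bsup>[n]\<^esup>\<close> for large \<open>n\<close>, so it is induced by a map \<open>g \<mapsto> \<Phi>(u (g \<otimes> 1))\<close>; conversely
  such a map descends to \<open>R\<close> if \<open>u \<in> (d(I)P + \<Delta>\<^bsup>[n]\<^esup> : IP)\<close>. For some multiple of \<open>u\<close> it sends \<open>f\<close> to a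
  unit iff \<open>f u \<notin> d(\<mm>)P + \<Delta>\<^bsup>[n]\<^esup>\<close>, and this ideal is \<open>\<mm>\<^bsup>[n]\<^esup>P + d(\<mm>)P\<close> because \<open>y\<^sub>i\<close> and
  \<open>x\<^sub>i \<otimes> 1\<close> agree modulo \<open>d(\<mm>)P\<close>. Since \<open>R\<close> is local, it is \<open>D\<close>-simple iff every nonzero
  \<open>f\<close> is sent to a unit by some operator.\<close>


section \<open>Congruences modulo an ideal\<close>

text \<open>Freeness over the right factor comes from a pair of maps that are inverse to each other
  modulo \<open>Y_ideal n\<close> and \<open>diag_frob n\<close>: \<open>diag_eval\<close>
  substitutes the diagonal differences for the variables y, and \<open>tensor_taylor\<close> expands
  the left factor as a Taylor polynomial in y. The obstacle is localization. A fraction a / s has no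
  polynomial expansion; s can be inverted only once the y are nilpotent, when its expansion is a
  unit plus a nilpotent. So the expansion exists only modulo \<open>Y_ideal n\<close>, is picked by
  choice, and is additive and multiplicative only up to congruence. Functionals on P and operators
  on R are likewise evaluated on chosen representatives. This is why the proof works with functions
  and congruences modulo ideals of fixed rings, and passes to the quotient ring only at the end, for
  the operators. The two numerical bounds have different sources. Each factor
  \<open>left_incl r - right_incl r\<close> lowers the order of an operator by one, so order N leads
  to n = N + 1. Conversely a monomial of total degree d n has an exponent at least n, so level n
  gives operators of order at most d n.\<close>

locale type_ideal =
  fixes J :: "'a::comm_ring_1 set"
  assumes ideal_J: "ideal J ring_of_type_algebra"
begin

lemma zero_closed: "0 \<in> J"
  and add_closed: "x \<in> J \<Longrightarrow> y \<in> J \<Longrightarrow> x + y \<in> J"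
  and mult_closed_left: "x \<in> J \<Longrightarrow> r * x \<in> J"
  using ideal_J by (auto simp: ideal_ring_of_type_iff)

lemma mult_closed_right: "x \<in> J \<Longrightarrow> x * r \<in> J"
  using mult_closed_left[of x r] by (simp add: mult.commute)

lemma uminus_closed: "x \<in> J \<Longrightarrow> - x \<in> J"
  using mult_closed_left[of x "- 1"] by simp

lemma diff_closed: "x \<in> J \<Longrightarrow> y \<in> J \<Longrightarrow> x - y \<in> J"
  using add_closed[OF _ uminus_closed, of x y] by simp

lemma sum_closed: "(\<And>i. i \<in> A \<Longrightarrow> f i \<in> J) \<Longrightarrow> sum f A \<in> J"
  by (induction A rule: infinite_finite_induct) (auto simp: zero_closed add_closed)

lemma unit_cancel:
  assumes "x * u \<in> J" "u * v = 1"
  shows "x \<in> J"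
  using mult_closed_right[OF assms(1), of v] assms(2) by (simp add: mult.assoc)

definition cong :: "'a \<Rightarrow> 'a \<Rightarrow> bool" (infix "\<approx>" 50)
  where "x \<approx> y \<longleftrightarrow> x - y \<in> J"

lemma cong_refl: "x \<approx> x"
  by (simp add: cong_def zero_closed)

lemma cong_sym: "x \<approx> y \<Longrightarrow> y \<approx> x"
  unfolding cong_def using uminus_closed by fastforce

lemma cong_trans [trans]: "x \<approx> y \<Longrightarrow> y \<approx> z \<Longrightarrow> x \<approx> z"
  unfolding cong_def using add_closed by fastforce

lemma cong_add: "x \<approx> x' \<Longrightarrow> y \<approx> y' \<Longrightarrow> x + y \<approx> x' + y'"
  unfolding cong_def using add_closed by (fastforce simp: algebra_simps)

lemma cong_diff: "x \<approx> x' \<Longrightarrow> y \<approx> y' \<Longrightarrow> x - y \<approx> x' - y'"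
  unfolding cong_def using diff_closed by (fastforce simp: algebra_simps)

lemma cong_mult:
  assumes "x \<approx> x'" "y \<approx> y'"
  shows "x * y \<approx> x' * y'"
proof -
  have "x * y - x' * y' = (x - x') * y + x' * (y - y')"
    by (simp add: algebra_simps)
  then show ?thesis
    using assms by (simp add: cong_def add_closed mult_closed_left mult_closed_right)
qed

lemma cong_mem_iff: "x \<approx> y \<Longrightarrow> x \<in> J \<longleftrightarrow> y \<in> J"
  unfolding cong_def using add_closed[of "x - y" y] diff_closed[of x "x - y"] by auto

lemma cong_zero_iff: "x \<approx> 0 \<longleftrightarrow> x \<in> J"
  by (simp add: cong_def)

end

lemma type_ideal_ideal_gen: "type_ideal (ideal_gen A)"
  by (rule type_ideal.intro ideal_ideal_gen)+

lemma mem_ideal_sum_iff: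
  "x \<in> ideal_sum A B \<longleftrightarrow> (\<exists>a\<in>A. \<exists>b\<in>B. x = a + b)" for x :: "'a::comm_ring_1"
  by (simp add: set_add_def set_mult_def ring_of_type_algebra_def)

lemma type_ideal_ideal_sum:
  fixes A B :: "'a::comm_ring_1 set"
  assumes "type_ideal A" "type_ideal B"
  shows "type_ideal (ideal_sum A B)"
proof -
  interpret A: type_ideal A by (rule assms)
  interpret B: type_ideal B by (rule assms)
  show ?thesis
  proof (rule type_ideal.intro, unfold ideal_ring_of_type_iff, intro conjI ballI allI)
    show "0 \<in> ideal_sum A B"
      using A.zero_closed B.zero_closed by (force simp: mem_ideal_sum_iff)
  next
    fix x y assume "x \<in> ideal_sum A B" "y \<in> ideal_sum A B"
    then obtain a b a' b' where *: "a \<in> A" "b \<in> B" "a' \<in> A" "b' \<in> B" "x = a + b" "y = a' + b'"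
      by (auto simp: mem_ideal_sum_iff)
    then have "x + y = (a + a') + (b + b')" by (simp add: algebra_simps)
    with * show "x + y \<in> ideal_sum A B"
      unfolding mem_ideal_sum_iff by (meson A.add_closed B.add_closed)
  next
    fix x r assume "x \<in> ideal_sum A B"
    then obtain a b where *: "a \<in> A" "b \<in> B" "x = a + b"
      by (auto simp: mem_ideal_sum_iff)
    then have "r * x = r * a + r * b" by (simp add: algebra_simps)
    with * show "r * x \<in> ideal_sum A B"
      unfolding mem_ideal_sum_iff by (meson A.mult_closed_left B.mult_closed_left)
  qed
qed

lemma ideal_sum_left:
  "type_ideal B \<Longrightarrow> x \<in> A \<Longrightarrow> x \<in> ideal_sum A B" for x :: "'a::comm_ring_1"
  using type_ideal.zero_closed[of B] by (force simp: mem_ideal_sum_iff)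

lemma ideal_sum_right:
  "type_ideal A \<Longrightarrow> x \<in> B \<Longrightarrow> x \<in> ideal_sum A B" for x :: "'a::comm_ring_1"
  using type_ideal.zero_closed[of A] by (force simp: mem_ideal_sum_iff)

lemma ideal_sum_minimal:
  assumes "type_ideal J" "A \<subseteq> J" "B \<subseteq> J"
  shows "ideal_sum A B \<subseteq> (J :: 'a::comm_ring_1 set)"
  using assms(2,3) type_ideal.add_closed[OF assms(1)] by (fastforce simp: mem_ideal_sum_iff)

lemma ideal_gen_subset:
  "type_ideal J \<Longrightarrow> A \<subseteq> J \<Longrightarrow> ideal_gen A \<subseteq> (J :: 'a::comm_ring_1 set)"
  by (rule ideal_gen_minimal[OF type_ideal.ideal_J])

text \<open>Multiples of an admissible \<open>u\<close> stay admissible. This is used for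
  \<open>u * v\<close>, with \<open>v\<close> a test element of the pairing, and for
  \<open>u * (left_incl r - right_incl r)\<close>, which corresponds to a commutator.\<close>

lemma type_ideal_ideal_colon:
  assumes "type_ideal J"
  shows "type_ideal (ideal_colon J A)"
proof -
  interpret type_ideal J by (rule assms)
  show ?thesis
    by (rule type_ideal.intro)
       (auto simp: ideal_ring_of_type_iff ideal_colon_def zero_closed distrib_right mult.assoc
         intro: add_closed mult_closed_left)
qed


section \<open>Polynomials as finitely supported functions\<close>

lemma poly_mapping_additive_induct [case_names single add]:
  fixes p :: "'a \<Rightarrow>\<^sub>0 'b::comm_monoid_add"
  assumes single: "\<And>m c. P (Poly_Mapping.single m c)"
    and add: "\<And>p q. P p \<Longrightarrow> P q \<Longrightarrow> P (p + q)"
  shows "P p"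
proof (induction p rule: update_induct)
  case const
  show ?case using single[of undefined 0] by simp
next
  case (update p a b)
  have "Poly_Mapping.update a b p = p + Poly_Mapping.single a b"
    using update by (intro poly_mapping_eqI) (auto simp: lookup_update lookup_add lookup_single in_keys_iff when_def)
  then show ?case using single add update by simp
qed

text \<open>Exponents cancel, so multiplication by a monomial moves each coefficient to a place of
  its own. In this way any coefficient can be brought to the top exponent.\<close>

lemma lookup_single_times:
  fixes p :: "'a::cancel_comm_monoid_add \<Rightarrow>\<^sub>0 'b::comm_ring_1"
  shows "Poly_Mapping.lookup (Poly_Mapping.single m c * p) (m + a) = c * Poly_Mapping.lookup p a"
proof (induction p rule: poly_mapping_additive_induct)
  case (single m' c')
  show ?case by (simp add: mult_single lookup_single when_def)
next
  case (add p q)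
  then show ?case by (simp add: distrib_left lookup_add)
qed

text \<open>A counterpart of \<open>mvar\<close> over any commutative coefficient ring, since Taylor
  polynomials have coefficients in S.\<close>

definition yvar :: "'n \<Rightarrow> ('n \<Rightarrow>\<^sub>0 nat) \<Rightarrow>\<^sub>0 'a::comm_ring_1"
  where "yvar i = Poly_Mapping.single (Poly_Mapping.single i 1) 1"

abbreviation const :: "'a::comm_ring_1 \<Rightarrow> ('n \<Rightarrow>\<^sub>0 nat) \<Rightarrow>\<^sub>0 'a"
  where "const c \<equiv> Poly_Mapping.single 0 c"

lemma const_mult: "const (a * b) = const a * const b"
  by (simp add: mult_single)

lemma single_eq_prod:
  fixes m :: "'n::finite \<Rightarrow>\<^sub>0 nat" and c :: "'a::comm_ring_1"
  shows "Poly_Mapping.single m c = const c * (\<Prod>i\<in>UNIV. yvar i ^ Poly_Mapping.lookup m i)"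
proof -
  have pow: "yvar i ^ k = Poly_Mapping.single (Poly_Mapping.single i k) (1::'a)" for i :: 'n and k
  proof (induction k)
    case (Suc k)
    have "Poly_Mapping.single i 1 + Poly_Mapping.single i k = Poly_Mapping.single i (Suc k)"
      by (metis plus_1_eq_Suc single_add)
    with Suc show ?case by (simp add: yvar_def mult_single)
  qed simp
  have prod: "(\<Prod>i\<in>A. Poly_Mapping.single (f i) (1::'a)) = Poly_Mapping.single (sum f A) 1"
    if "finite A" for A and f :: "'n \<Rightarrow> 'n \<Rightarrow>\<^sub>0 nat"
    using that by (induction A) (auto simp: mult_single)
  have "(\<Sum>i\<in>UNIV. Poly_Mapping.single i (Poly_Mapping.lookup m i)) = m"
    by (intro poly_mapping_eqI) (simp add: lookup_sum lookup_single when_def)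
  then show ?thesis by (simp add: pow prod mult_single)
qed

text \<open>Constants and variables generate the polynomial ring. Only closure under sums and
  products is asked for, so the rule also compares maps that are homomorphisms merely up to
  congruence.\<close>

lemma polynomial_induct [case_names const var add mult]:
  fixes p :: "('n::finite \<Rightarrow>\<^sub>0 nat) \<Rightarrow>\<^sub>0 'a::comm_ring_1"
  assumes const: "\<And>c. P (const c)" and var: "\<And>i. P (yvar i)"
    and add: "\<And>p q. P p \<Longrightarrow> P q \<Longrightarrow> P (p + q)"
    and mult: "\<And>p q. P p \<Longrightarrow> P q \<Longrightarrow> P (p * q)"
  shows "P p"
proof (induction p rule: poly_mapping_additive_induct)
  case (single m c)
  have one: "P 1" using const[of 1] by simp
  have pow: "P (yvar i ^ k)" for i k
    by (induction k) (auto simp: one var mult)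
  have prod: "P (\<Prod>i\<in>A. yvar i ^ k i)" if "finite A" for A k
    using that
  proof (induction A)
    case (insert i A)
    have "P (yvar i ^ k i * (\<Prod>i\<in>A. yvar i ^ k i))" by (rule mult[OF pow insert.IH])
    with insert show ?case by simp
  qed (simp add: one)
  show ?case by (subst single_eq_prod) (rule mult[OF const prod[OF finite]])
qed (rule add)

definition poly_eval ::
    "('a::comm_ring_1 \<Rightarrow> 'b::comm_ring_1) \<Rightarrow> ('n::finite \<Rightarrow> 'b) \<Rightarrow> (('n \<Rightarrow>\<^sub>0 nat) \<Rightarrow>\<^sub>0 'a) \<Rightarrow> 'b"
  where "poly_eval \<phi> v p =
    (\<Sum>m\<in>Poly_Mapping.keys p. \<phi> (Poly_Mapping.lookup p m) * (\<Prod>i\<in>UNIV. v i ^ Poly_Mapping.lookup m i))"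

locale eval_hom =
  fixes \<phi> :: "'a::comm_ring_1 \<Rightarrow> 'b::comm_ring_1" and v :: "'n::finite \<Rightarrow> 'b"
  assumes hom_add: "\<phi> (a + b) = \<phi> a + \<phi> b"
    and hom_mult: "\<phi> (a * b) = \<phi> a * \<phi> b"
    and hom_one: "\<phi> 1 = 1"
begin

lemma hom_zero: "\<phi> 0 = 0"
  using hom_add[of 0 0] by simp

abbreviation "ev \<equiv> poly_eval \<phi> v"

lemma eval_single: "ev (Poly_Mapping.single m c) = \<phi> c * (\<Prod>i\<in>UNIV. v i ^ Poly_Mapping.lookup m i)"
  by (simp add: poly_eval_def hom_zero)

lemma eval_const: "ev (const c) = \<phi> c"
  by (simp add: eval_single)

lemma eval_zero: "ev 0 = 0"
  by (simp add: poly_eval_def)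

lemma eval_one: "ev 1 = 1"
  using eval_const[of 1] by (simp add: hom_one)

lemma eval_add: "ev (p + q) = ev p + ev q"
proof -
  let ?g = "\<lambda>p m. \<phi> (Poly_Mapping.lookup p m) * (\<Prod>i\<in>UNIV. v i ^ Poly_Mapping.lookup m i)"
  let ?K = "Poly_Mapping.keys p \<union> Poly_Mapping.keys q"
  have *: "ev r = sum (?g r) ?K" if "Poly_Mapping.keys r \<subseteq> ?K" for r
    unfolding poly_eval_def using that
    by (intro sum.mono_neutral_left) (auto simp: in_keys_iff hom_zero)
  have "ev (p + q) = sum (?g (p + q)) ?K" by (rule *) (rule keys_add)
  also have "\<dots> = sum (?g p) ?K + sum (?g q) ?K"
    by (simp add: lookup_add hom_add distrib_right sum.distrib)
  also have "\<dots> = ev p + ev q" by (simp add: *)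
  finally show ?thesis .
qed

lemma eval_diff: "ev (p - q) = ev p - ev q"
  using eval_add[of "p - q" q] by simp

lemma eval_var: "ev (yvar i) = v i"
proof -
  have "ev (yvar i) = (\<Prod>j\<in>UNIV. if j = i then v i else 1)"
    unfolding yvar_def eval_single hom_one mult_1
    by (intro prod.cong refl) (simp add: lookup_single when_def)
  then show ?thesis by simp
qed

lemma eval_mult: "ev (p * q) = ev p * ev q"
proof (induction p rule: poly_mapping_additive_induct)
  case (single m c)
  show ?case
  proof (induction q rule: poly_mapping_additive_induct)
    case (single m' c')
    show ?case
      unfolding mult_single eval_single hom_mult lookup_add power_add prod.distrib
      by (simp only: mult_ac)
  qed (simp add: eval_add distrib_left)
qed (simp add: eval_add distrib_right)

lemma eval_power: "ev (p ^ k) = ev p ^ k"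
  by (induction k) (simp_all add: eval_one eval_mult)

end


section \<open>The local ring and its tensor square\<close>

lemma frac_rel_one: "frac_rel (p, 1) (p, 1)"
  by (simp add: frac_rel_refl_iff one_notin_origin_ideal)

lemma abs_locpoly_eq_iff:
  "frac_rel x x \<Longrightarrow> frac_rel y y \<Longrightarrow> abs_locpoly x = abs_locpoly y \<longleftrightarrow> frac_rel x y"
  using Quotient3_rel[OF Quotient3_locpoly, of x y] by blast

lemma loc_add: "loc (p + q) = loc p + loc q"
  by (simp add: loc_def plus_locpoly.abs_eq[OF frac_rel_one frac_rel_one])

lemma loc_mult: "loc (p * q) = loc p * loc q"
  by (simp add: loc_def times_locpoly.abs_eq[OF frac_rel_one frac_rel_one])

lemma loc_one: "loc 1 = 1"
  by (simp add: loc_def one_locpoly_def)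

lemma loc_eval_loc: "loc_eval (loc p) = Poly_Mapping.lookup p 0"
  by (simp add: loc_def loc_eval.abs_eq[OF frac_rel_one] lookup_one)

lemma loc_eq_iff: "loc p = loc q \<longleftrightarrow> (\<exists>u. u \<notin> origin_ideal \<and> u * (p - q) = 0)"
  by (simp add: loc_def abs_locpoly_eq_iff frac_rel_one)
     (simp add: frac_rel_def one_notin_origin_ideal)

lemma loc_fraction:
  obtains a s where "s \<notin> origin_ideal" "g * loc s = loc a"
proof -
  obtain a s where g: "frac_rel (a, s) (a, s)" "g = abs_locpoly (a, s)"
    by (metis Quotient3_abs_rep[OF Quotient3_locpoly] Quotient3_rep_reflp[OF Quotient3_locpoly] surj_pair)
  have s: "s \<notin> origin_ideal" using g(1) by (simp add: frac_rel_refl_iff)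
  have "g * loc s = abs_locpoly (a * s, s)"
    by (simp add: g(2) loc_def times_locpoly.abs_eq[OF g(1) frac_rel_one])
  also have "\<dots> = loc a"
    unfolding loc_def
    by (subst abs_locpoly_eq_iff) (simp_all add: frac_relI s mult_notin_origin_ideal one_notin_origin_ideal)
  finally show thesis using s that by blast
qed

lemma loc_unit:
  assumes "s \<notin> origin_ideal"
  obtains z where "loc s * z = 1"
proof -
  have s: "frac_rel (1, s) (1, s)" using assms by (simp add: frac_rel_refl_iff)
  have "loc s * abs_locpoly (1, s) = abs_locpoly (s, s)"
    by (simp add: loc_def times_locpoly.abs_eq[OF frac_rel_one s])
  also have "\<dots> = 1"
    unfolding one_locpoly_def
    by (subst abs_locpoly_eq_iff) (simp_all add: frac_relI assms one_notin_origin_ideal)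
  finally show thesis by (rule that)
qed

text \<open>If a fraction does not vanish at the origin, neither does its numerator, which is then
  an admissible denominator. This is the locality of S.\<close>

lemma loc_eval_nonzero_unit:
  assumes "loc_eval g \<noteq> 0"
  obtains z where "g * z = 1"
proof -
  obtain a s where as: "s \<notin> origin_ideal" "g * loc s = loc a" by (rule loc_fraction)
  from arg_cong[OF as(2), of loc_eval] as(1) assms have "a \<notin> origin_ideal"
    by (auto simp: loc_eval_simps loc_eval_loc origin_ideal_iff)
  then obtain z where "loc a * z = 1" by (rule loc_unit)
  with as(2) have "g * (loc s * z) = 1" by (metis mult.assoc)
  then show thesis by (rule that)
qed

lemma loc_eval_zero: "loc_eval 0 = 0"
  by (metis add_cancel_right_left loc_eval_simps(1))

lemma mem_max_ideal_iff: "g \<in> max_ideal \<longleftrightarrow> loc_eval g = 0"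
proof
  have "type_ideal {g :: ('a, 'b) locpoly. loc_eval g = 0}"
    by (rule type_ideal.intro) (auto simp: ideal_ring_of_type_iff loc_eval_simps loc_eval_zero)
  then have "max_ideal \<subseteq> {g :: ('a, 'b) locpoly. loc_eval g = 0}"
    unfolding max_ideal_def by (rule ideal_gen_subset) (auto simp: loc_eval_loc origin_ideal_iff)
  then show "g \<in> max_ideal \<Longrightarrow> loc_eval g = 0" by blast
next
  assume g: "loc_eval g = 0"
  obtain a s where as: "s \<notin> origin_ideal" "g * loc s = loc a" by (rule loc_fraction)
  from arg_cong[OF as(2), of loc_eval] g have "a \<in> origin_ideal"
    by (simp add: loc_eval_simps loc_eval_loc origin_ideal_iff)
  then have "loc a \<in> max_ideal"
    unfolding max_ideal_def using ideal_gen_superset[of "loc ` origin_ideal"] by auto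
  moreover obtain z where "loc s * z = 1" using as(1) by (rule loc_unit)
  ultimately show "g \<in> max_ideal"
    using as(2) type_ideal.unit_cancel[of max_ideal g "loc s" z]
    by (simp add: max_ideal_def type_ideal_ideal_gen)
qed

lemma type_ideal_max_ideal: "type_ideal max_ideal"
  unfolding max_ideal_def by (rule type_ideal_ideal_gen)

lemma type_ideal_proper_subset_max:
  assumes "type_ideal I" "1 \<notin> I"
  shows "I \<subseteq> max_ideal"
proof
  fix g assume g: "g \<in> I"
  show "g \<in> max_ideal"
  proof (rule ccontr)
    assume "g \<notin> max_ideal"
    then obtain z where "g * z = 1"
      using loc_eval_nonzero_unit by (metis mem_max_ideal_iff)
    with type_ideal.mult_closed_right[OF assms(1) g, of z] assms(2) show False by simp
  qed
qed

lemma loc_const_add: "loc_const (a + b) = loc_const a + loc_const b"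
  by (simp add: loc_const_def mconst_def single_add loc_add)

lemma loc_const_mult: "loc_const (a * b) = loc_const a * loc_const b"
  unfolding loc_const_def mconst_def loc_mult[symmetric] by (simp add: mult_single)

lemma loc_const_one: "loc_const 1 = 1"
  by (simp add: loc_const_def mconst_def loc_one)

section \<open>Pure tensors, and additive maps out of the tensor square\<close>

lemma tensor_eqI: "x - y \<in> tensor_rels loc_const loc_const \<Longrightarrow> abs_locpoly2 x = abs_locpoly2 y"
  by (simp add: locpoly2.abs_eq_iff)

lemma tensor_add_left: "tensor (a + a') b = tensor a b + tensor a' b"
  unfolding tensor_def plus_locpoly2.abs_eq
  by (rule tensor_eqI) (use tensor_rels.add_left in \<open>fastforce simp: diff_diff_eq\<close>)

lemma tensor_add_right: "tensor a (b + b') = tensor a b + tensor a b'"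
  unfolding tensor_def plus_locpoly2.abs_eq
  by (rule tensor_eqI) (use tensor_rels.add_right in \<open>fastforce simp: diff_diff_eq\<close>)

lemma tensor_balanced: "tensor (loc_const c * a) b = tensor a (loc_const c * b)"
  unfolding tensor_def by (rule tensor_eqI) (rule tensor_rels.balanced)

lemma tensor_mult: "tensor a b * tensor a' b' = tensor (a * a') (b * b')"
  by (simp add: tensor_def times_locpoly2.abs_eq tensor_times_of)

lemma tensor_one: "tensor 1 1 = 1"
  by (simp add: tensor_def one_locpoly2_def)

lemma left_incl_add: "left_incl (a + b) = left_incl a + left_incl b"
  by (simp add: left_incl_def tensor_add_left)

lemma left_incl_mult: "left_incl (a * b) = left_incl a * left_incl b"
  by (simp add: left_incl_def tensor_mult)

lemma left_incl_one: "left_incl 1 = 1"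
  by (simp add: left_incl_def tensor_one)

lemma left_incl_power: "left_incl (a ^ k) = left_incl a ^ k"
  by (induction k) (simp_all add: left_incl_one left_incl_mult)

lemma left_incl_zero: "left_incl 0 = 0"
  using left_incl_add[of 0 0] by simp

lemma right_incl_add: "right_incl (a + b) = right_incl a + right_incl b"
  by (simp add: right_incl_def tensor_add_right)

lemma right_incl_mult: "right_incl (a * b) = right_incl a * right_incl b"
  by (simp add: right_incl_def tensor_mult)

lemma right_incl_one: "right_incl 1 = 1"
  by (simp add: right_incl_def tensor_one)

lemma left_incl_loc_const: "left_incl (loc_const c) = right_incl (loc_const c)"
  using tensor_balanced[of c 1 1] by (simp add: left_incl_def right_incl_def)

lemma tensor_eq_incl: "tensor a b = left_incl a * right_incl b"
  by (simp add: left_incl_def right_incl_def tensor_mult)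

text \<open>Differences of pure tensors exhaust P. The zero case of \<open>frag_induction\<close> is
  absorbed because 0 is the pure tensor \<open>tensor 0 1\<close>.\<close>

lemma tensor_induct [case_names tensor diff]:
  assumes tensor: "\<And>a b. P (tensor a b)"
    and diff: "\<And>v w. P v \<Longrightarrow> P w \<Longrightarrow> P (v - w)"
  shows "P w"
proof -
  have "P (abs_locpoly2 x)" for x
  proof (induction x rule: frag_induction[OF subset_UNIV])
    case 1
    have "tensor 0 1 = (0 :: ('a, 'b) locpoly2)"
      using left_incl_zero by (simp add: left_incl_def)
    then show ?case using tensor[of 0 1] by (simp add: zero_locpoly2_def)
  next
    case (2 p)
    then show ?case using tensor[of "fst p" "snd p"] by (simp add: tensor_def)
  next
    case (3 x y)
    then show ?case using diff by (simp flip: minus_locpoly2.abs_eq)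
  qed
  then show ?thesis by (metis Quotient3_abs_rep[OF Quotient3_locpoly2])
qed

definition tensor_lift ::
    "(('n, 'k::field) locpoly \<Rightarrow> ('n, 'k) locpoly \<Rightarrow> 'm::comm_ring_1) \<Rightarrow> ('n, 'k) locpoly2 \<Rightarrow> 'm"
  where "tensor_lift F w = (\<Sum>p\<in>Poly_Mapping.keys (rep_locpoly2 w).
    of_int (Poly_Mapping.lookup (rep_locpoly2 w) p) * F (fst p) (snd p))"

text \<open>Since \<^const>\<open>tensor_lift\<close> evaluates \<open>F\<close> on a chosen representative, it is additive only
  modulo an ideal modulo which \<open>F\<close> is bilinear.\<close>

locale bilinear_mod = type_ideal J for J :: "'m::comm_ring_1 set" +
  fixes F :: "('n, 'k::field) locpoly \<Rightarrow> ('n, 'k) locpoly \<Rightarrow> 'm"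
  assumes F_add_left: "F (a + a') b \<approx> F a b + F a' b"
    and F_add_right: "F a (b + b') \<approx> F a b + F a b'"
    and F_balanced: "F (loc_const c * a) b \<approx> F a (loc_const c * b)"
begin

text \<open>On formal sums the extension of \<open>F\<close> is exactly additive; the ideal
  \<open>J\<close> enters only through the bilinearity relations.\<close>

definition frag_eval :: "(('n, 'k) locpoly \<times> ('n, 'k) locpoly \<Rightarrow>\<^sub>0 int) \<Rightarrow> 'm"
  where "frag_eval x = (\<Sum>p\<in>Poly_Mapping.keys x. of_int (Poly_Mapping.lookup x p) * F (fst p) (snd p))"

lemma frag_eval_diff: "frag_eval (x - y) = frag_eval x - frag_eval y"
proof -
  let ?g = "\<lambda>x p. of_int (Poly_Mapping.lookup x p) * F (fst p) (snd p)"
  let ?K = "Poly_Mapping.keys x \<union> Poly_Mapping.keys y"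
  have *: "frag_eval z = sum (?g z) ?K" if "Poly_Mapping.keys z \<subseteq> ?K" for z
    unfolding frag_eval_def using that
    by (intro sum.mono_neutral_left) (auto simp: in_keys_iff)
  have "frag_eval (x - y) = sum (?g (x - y)) ?K" by (rule *) (rule keys_diff)
  also have "\<dots> = sum (?g x) ?K - sum (?g y) ?K"
    by (simp add: lookup_minus left_diff_distrib sum_subtractf)
  finally show ?thesis by (simp add: *)
qed

lemma frag_eval_of: "frag_eval (frag_of (a, b)) = F a b"
  by (simp add: frag_eval_def)

lemma frag_eval_rels: "x \<in> tensor_rels loc_const loc_const \<Longrightarrow> frag_eval x \<in> J"
proof (induction x rule: tensor_rels.induct)
  case (add_left a a' b)
  show ?case
    using F_add_left[of a a' b] unfolding frag_eval_diff frag_eval_of cong_def by (simp add: diff_diff_eq)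
next
  case (add_right a b b')
  show ?case
    using F_add_right[of a b b'] unfolding frag_eval_diff frag_eval_of cong_def by (simp add: diff_diff_eq)
next
  case (balanced c a b)
  show ?case using F_balanced[of c a b] by (simp add: frag_eval_diff frag_eval_of cong_def)
next
  case zero
  show ?case by (simp add: frag_eval_def zero_closed)
qed (simp add: frag_eval_diff diff_closed)

text \<open>The representative chosen in \<open>tensor_lift\<close> differs from \<open>x\<close> by
  a bilinearity relation, and \<open>frag_eval\<close> sends relations into
  \<open>J\<close>.\<close>

lemma lift_abs: "tensor_lift F (abs_locpoly2 x) \<approx> frag_eval x"
proof -
  have "abs_locpoly2 (rep_locpoly2 (abs_locpoly2 x)) = abs_locpoly2 x"
    by (rule Quotient3_abs_rep[OF Quotient3_locpoly2])
  then have "frag_eval (rep_locpoly2 (abs_locpoly2 x) - x) \<in> J"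
    by (intro frag_eval_rels) (simp add: locpoly2.abs_eq_iff)
  then show ?thesis
    by (simp add: cong_def frag_eval_diff) (simp add: tensor_lift_def frag_eval_def)
qed

lemma lift_tensor: "tensor_lift F (tensor a b) \<approx> F a b"
  using lift_abs[of "frag_of (a, b)"] by (simp add: tensor_def frag_eval_of)

lemma lift_diff: "tensor_lift F (v - w) \<approx> tensor_lift F v - tensor_lift F w"
proof -
  obtain x y where [simp]: "v = abs_locpoly2 x" "w = abs_locpoly2 y"
    by (metis Quotient3_abs_rep[OF Quotient3_locpoly2])
  have "tensor_lift F (v - w) \<approx> frag_eval x - frag_eval y"
    using lift_abs[of "x - y"] by (simp add: minus_locpoly2.abs_eq frag_eval_diff)
  moreover have "tensor_lift F v - tensor_lift F w \<approx> frag_eval x - frag_eval y"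
    by (simp add: cong_diff lift_abs)
  ultimately show ?thesis using cong_trans cong_sym by blast
qed

lemma lift_zero: "tensor_lift F 0 \<approx> 0"
  using lift_diff[of 0 0] by simp

lemma lift_add: "tensor_lift F (v + w) \<approx> tensor_lift F v + tensor_lift F w"
proof -
  have "tensor_lift F v \<approx> tensor_lift F (v + w) - tensor_lift F w"
    using lift_diff[of "v + w" w] by simp
  then show ?thesis unfolding cong_def using uminus_closed by (fastforce simp: algebra_simps)
qed

end


section \<open>Taylor expansion\<close>

text \<open>The ideal generated by the powers \<open>yvar i ^ n\<close>, described by its monomials.
  In this form the coefficients at exponents below n visibly depend only on the class modulo the
  ideal.\<close>

definition Y_ideal :: "nat \<Rightarrow> (('n \<Rightarrow>\<^sub>0 nat) \<Rightarrow>\<^sub>0 'a::comm_ring_1) set"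
  where "Y_ideal n = {p. \<forall>a\<in>Poly_Mapping.keys p. \<exists>i. n \<le> Poly_Mapping.lookup a i}"

definition total_degree :: "('n::finite \<Rightarrow>\<^sub>0 nat) \<Rightarrow> nat"
  where "total_degree a = (\<Sum>i\<in>UNIV. Poly_Mapping.lookup a i)"

text \<open>The k-th power of the ideal generated by the variables. This filtration controls
  nilpotence, and later the order of operators.\<close>

definition degree_ge :: "nat \<Rightarrow> (('n::finite \<Rightarrow>\<^sub>0 nat) \<Rightarrow>\<^sub>0 'a::comm_ring_1) set"
  where "degree_ge k = {p. \<forall>a\<in>Poly_Mapping.keys p. k \<le> total_degree a}"

lemma total_degree_add: "total_degree (a + b) = total_degree a + total_degree b"
  by (simp add: total_degree_def lookup_add sum.distrib)

lemma type_ideal_Y: "type_ideal (Y_ideal n :: (('n \<Rightarrow>\<^sub>0 nat) \<Rightarrow>\<^sub>0 'a::comm_ring_1) set)"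
proof (rule type_ideal.intro, unfold ideal_ring_of_type_iff, intro conjI ballI allI)
  fix p q :: "('n \<Rightarrow>\<^sub>0 nat) \<Rightarrow>\<^sub>0 'a"
  assume "p \<in> Y_ideal n" "q \<in> Y_ideal n"
  then show "p + q \<in> Y_ideal n"
    using keys_add[of p q] by (auto simp: Y_ideal_def)
next
  fix p r :: "('n \<Rightarrow>\<^sub>0 nat) \<Rightarrow>\<^sub>0 'a"
  assume p: "p \<in> Y_ideal n"
  show "r * p \<in> Y_ideal n"
    unfolding Y_ideal_def
  proof safe
    fix a assume "a \<in> Poly_Mapping.keys (r * p)"
    then obtain b c where *: "c \<in> Poly_Mapping.keys p" "a = b + c"
      using keys_mult[of r p] by blast
    then show "\<exists>i. n \<le> Poly_Mapping.lookup a i"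
      using p by (fastforce simp: Y_ideal_def lookup_add intro: trans_le_add2)
  qed
qed (simp add: Y_ideal_def)

lemma degree_ge_mult: "p \<in> degree_ge j \<Longrightarrow> q \<in> degree_ge k \<Longrightarrow> p * q \<in> degree_ge (j + k)"
  using keys_mult[of p q] by (fastforce simp: degree_ge_def total_degree_add intro: add_mono)

lemma degree_ge_zero: "p \<in> degree_ge 0"
  by (simp add: degree_ge_def)

lemma type_ideal_degree_ge:
  "type_ideal (degree_ge k :: (('n::finite \<Rightarrow>\<^sub>0 nat) \<Rightarrow>\<^sub>0 'a::comm_ring_1) set)"
proof (rule type_ideal.intro, unfold ideal_ring_of_type_iff, intro conjI ballI allI)
  fix p q :: "('n \<Rightarrow>\<^sub>0 nat) \<Rightarrow>\<^sub>0 'a"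
  assume "p \<in> degree_ge k" "q \<in> degree_ge k"
  then show "p + q \<in> degree_ge k"
    using keys_add[of p q] by (auto simp: degree_ge_def)
next
  fix p r :: "('n \<Rightarrow>\<^sub>0 nat) \<Rightarrow>\<^sub>0 'a"
  assume "p \<in> degree_ge k"
  from degree_ge_mult[OF degree_ge_zero this] show "r * p \<in> degree_ge k" by simp
qed (simp add: degree_ge_def)

lemma degree_ge_power: "p \<in> degree_ge 1 \<Longrightarrow> p ^ k \<in> degree_ge k"
  using degree_ge_mult[of p 1] by (induction k) (auto simp: degree_ge_zero)

text \<open>Pigeonhole: if all d exponents are below n, their sum is below d n.\<close>

lemma degree_ge_subset_Y: "degree_ge (card (UNIV :: 'n set) * n) \<subseteq> (Y_ideal n :: (('n::finite \<Rightarrow>\<^sub>0 nat) \<Rightarrow>\<^sub>0 'a::comm_ring_1) set)"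
proof
  fix p :: "('n \<Rightarrow>\<^sub>0 nat) \<Rightarrow>\<^sub>0 'a" assume p: "p \<in> degree_ge (card (UNIV :: 'n set) * n)"
  show "p \<in> Y_ideal n" unfolding Y_ideal_def
  proof safe
    fix a assume a: "a \<in> Poly_Mapping.keys p"
    show "\<exists>i. n \<le> Poly_Mapping.lookup a i"
    proof (rule ccontr)
      assume "\<not> ?thesis"
      then have "total_degree a < card (UNIV :: 'n set) * n"
        unfolding total_degree_def using sum_bounded_above_strict[of UNIV "Poly_Mapping.lookup a" n]
        by (simp add: not_le card_gt_0_iff)
      with a p show False by (auto simp: degree_ge_def)
    qed
  qed
qed

lemma Y_subset_degree_ge:
  assumes "n > 0"
  shows "Y_ideal n \<subseteq> (degree_ge 1 :: (('n::finite \<Rightarrow>\<^sub>0 nat) \<Rightarrow>\<^sub>0 'a::comm_ring_1) set)"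
proof
  fix p :: "('n \<Rightarrow>\<^sub>0 nat) \<Rightarrow>\<^sub>0 'a" assume p: "p \<in> Y_ideal n"
  show "p \<in> degree_ge 1" unfolding degree_ge_def
  proof safe
    fix a assume "a \<in> Poly_Mapping.keys p"
    with p obtain i where "n \<le> Poly_Mapping.lookup a i" by (auto simp: Y_ideal_def)
    also have "\<dots> \<le> total_degree a"
      unfolding total_degree_def by (rule member_le_sum) auto
    finally show "1 \<le> total_degree a" using assms by simp
  qed
qed

lemma yvar_degree_ge: "yvar i \<in> degree_ge 1"
proof -
  have "total_degree (Poly_Mapping.single i 1) = 1"
    by (simp add: total_degree_def lookup_single when_def)
  then show ?thesis by (simp add: degree_ge_def yvar_def)
qed

text \<open>The expansion of p(x + y) in powers of y. The coefficient variable x stands for the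
  right factor and y for left minus right, so that x + y becomes the left factor.\<close>

definition poly_taylor :: "('n::finite, 'k::field) mpoly \<Rightarrow> ('n \<Rightarrow>\<^sub>0 nat) \<Rightarrow>\<^sub>0 ('n, 'k) locpoly"
  where "poly_taylor = poly_eval (\<lambda>c. const (loc_const c)) (\<lambda>i. const (loc_var i) + yvar i)"

interpretation poly_taylor: eval_hom "\<lambda>c. const (loc_const c)" "\<lambda>i. const (loc_var i) + yvar i"
  rewrites "poly_eval (\<lambda>c. const (loc_const c)) (\<lambda>i. const (loc_var i) + yvar i) = poly_taylor"
  by unfold_locales
     (simp_all add: loc_const_add single_add loc_const_mult const_mult loc_const_one poly_taylor_def)

lemma loc_yvar: "loc (yvar i) = loc_var i"
  by (simp add: yvar_def loc_var_def mvar_def)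

lemma loc_const_eq: "loc (const c) = loc_const c"
  by (simp add: loc_const_def mconst_def)

text \<open>At y = 0 the expansion p(x + y) returns p(x). For a denominator p this isolates the part
  that is a unit.\<close>

lemma poly_taylor_degree: "poly_taylor p - const (loc p) \<in> degree_ge 1"
proof (induction p rule: polynomial_induct)
  case (const c)
  show ?case
    using type_ideal.zero_closed[OF type_ideal_degree_ge]
    by (simp add: poly_taylor.eval_const loc_const_eq)
next
  case (var i)
  show ?case by (simp only: poly_taylor.eval_var loc_yvar add_diff_cancel_left' yvar_degree_ge)
next
  case (add p q)
  then show ?case
    using type_ideal.cong_add[OF type_ideal_degree_ge]
    by (simp add: type_ideal.cong_def[OF type_ideal_degree_ge] poly_taylor.eval_add loc_add single_add)
next
  case (mult p q)
  then show ?case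
    using type_ideal.cong_mult[OF type_ideal_degree_ge]
    by (simp add: type_ideal.cong_def[OF type_ideal_degree_ge] poly_taylor.eval_mult loc_mult const_mult)
qed

text \<open>Modulo \<^const>\<open>Y_ideal\<close>, the expansion of \<open>s\<close> is a unit of the coefficient ring plus a nilpotent.\<close>

lemma poly_taylor_unit:
  fixes s :: "('n::finite, 'k::field) mpoly"
  assumes "s \<notin> origin_ideal"
  obtains t where "poly_taylor s * t - 1 \<in> Y_ideal n"
proof -
  interpret D: type_ideal "degree_ge 1 :: (('n \<Rightarrow>\<^sub>0 nat) \<Rightarrow>\<^sub>0 ('n, 'k) locpoly) set"
    by (rule type_ideal_degree_ge)
  interpret Y: type_ideal "Y_ideal n :: (('n \<Rightarrow>\<^sub>0 nat) \<Rightarrow>\<^sub>0 ('n, 'k) locpoly) set"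
    by (rule type_ideal_Y)
  obtain z where z: "loc s * z = 1" using assms by (rule loc_unit)
  \<comment> \<open>Multiplying by \<open>z\<close> makes the constant term of the expansion 1, so
    \<open>\<nu>\<close> has none and \<open>\<nu> ^ ?N\<close> falls into \<open>Y_ideal n\<close>.
    The finite geometric series in \<open>\<nu>\<close> then inverts
    \<open>1 - \<nu>\<close>.\<close>
  define \<nu> where "\<nu> = 1 - const z * poly_taylor s"
  let ?N = "card (UNIV :: 'n set) * n"
  have "const z * (poly_taylor s - const (loc s)) \<in> degree_ge 1"
    by (rule D.mult_closed_left[OF poly_taylor_degree])
  also have "const z * (poly_taylor s - const (loc s)) = - \<nu>"
    using z by (simp add: \<nu>_def right_diff_distrib const_mult[symmetric] mult.commute)
  finally have "\<nu> \<in> degree_ge 1" using D.uminus_closed by fastforce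
  then have "\<nu> ^ ?N \<in> Y_ideal n" using degree_ge_power degree_ge_subset_Y by blast
  moreover have "poly_taylor s * (const z * (\<Sum>k<?N. \<nu> ^ k)) = 1 - \<nu> ^ ?N"
    unfolding one_diff_power_eq[of \<nu> ?N] by (simp add: \<nu>_def mult_ac)
  then have "poly_taylor s * (const z * (\<Sum>k<?N. \<nu> ^ k)) - 1 = - (\<nu> ^ ?N)" by simp
  ultimately show thesis using that Y.uminus_closed by metis
qed

section \<open>Taylor expansion of fractions modulo \<open>Y_ideal n\<close>\<close>

context
  fixes n :: nat
begin

interpretation Y: type_ideal "Y_ideal n :: (('n::finite \<Rightarrow>\<^sub>0 nat) \<Rightarrow>\<^sub>0 ('n, 'k::field) locpoly) set"
  by (rule type_ideal_Y)

lemma poly_taylor_cancel: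
  fixes s :: "('n::finite, 'k::field) mpoly"
  assumes "s \<notin> origin_ideal" "Y.cong (x * poly_taylor s) (y * poly_taylor s)"
  shows "Y.cong x y"
proof -
  obtain t where "poly_taylor s * t - 1 \<in> Y_ideal n" using assms(1) by (rule poly_taylor_unit)
  then have t: "Y.cong (x * (poly_taylor s * t)) (x * 1)" for x
    by (intro Y.cong_mult Y.cong_refl) (simp add: Y.cong_def)
  have "Y.cong x (x * poly_taylor s * t)" using Y.cong_sym[OF t[of x]] by (simp add: mult_ac)
  also have "Y.cong \<dots> (y * poly_taylor s * t)" by (rule Y.cong_mult[OF assms(2) Y.cong_refl])
  also have "Y.cong \<dots> y" using t[of y] by (simp add: mult_ac)
  finally show ?thesis .
qed

text \<open>A quotient of the expansions of numerator and denominator, meaningful only modulo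
  \<open>Y_ideal n\<close>. The choice includes the fraction that represents \<open>g\<close>;
  \<open>taylor_times\<close> shows that the fraction does not matter.\<close>

definition taylor :: "('n::finite, 'k::field) locpoly \<Rightarrow> ('n \<Rightarrow>\<^sub>0 nat) \<Rightarrow>\<^sub>0 ('n, 'k) locpoly"
  where "taylor g = (SOME t. \<exists>a s. s \<notin> origin_ideal \<and> g * loc s = loc a \<and>
    t * poly_taylor s - poly_taylor a \<in> Y_ideal n)"

text \<open>The choice may have used another fraction b / r of \<open>g\<close>.
  Cross-multiplication gives a r = b s up to an element \<open>u\<close> outside
  \<open>origin_ideal\<close>, and expansions of such elements can be cancelled modulo
  \<open>Y_ideal n\<close>.\<close>

lemma taylor_times:
  assumes "s \<notin> origin_ideal" "g * loc s = loc a"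
  shows "Y.cong (taylor g * poly_taylor s) (poly_taylor a)"
proof -
  obtain t where t: "poly_taylor s * t - 1 \<in> Y_ideal n" using assms(1) by (rule poly_taylor_unit)
  have "poly_taylor a * t * poly_taylor s - poly_taylor a =
      poly_taylor a * (poly_taylor s * t - 1)"
    by (simp add: algebra_simps)
  then have "poly_taylor a * t * poly_taylor s - poly_taylor a \<in> Y_ideal n"
    by (simp add: t Y.mult_closed_left)
  with assms have "\<exists>t b r. r \<notin> origin_ideal \<and> g * loc r = loc b \<and>
      t * poly_taylor r - poly_taylor b \<in> Y_ideal n"
    by (intro exI[of _ "poly_taylor a * t"] exI[of _ a] exI[of _ s]) simp
  then have "\<exists>b r. r \<notin> origin_ideal \<and> g * loc r = loc b \<and>
      taylor g * poly_taylor r - poly_taylor b \<in> Y_ideal n"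
    unfolding taylor_def by (rule someI_ex)
  then obtain b r where br: "r \<notin> origin_ideal" "g * loc r = loc b"
      "Y.cong (taylor g * poly_taylor r) (poly_taylor b)"
    unfolding Y.cong_def by blast
  have "loc (a * r) = loc (b * s)"
    unfolding loc_mult assms(2)[symmetric] br(2)[symmetric] by (simp only: mult_ac)
  then obtain u where u: "u \<notin> origin_ideal" "u * (a * r - b * s) = 0"
    by (auto simp: loc_eq_iff)
  have "poly_taylor (u * (a * r - b * s)) = 0"
    by (simp only: u(2) poly_taylor.eval_zero)
  then have "Y.cong (poly_taylor a * poly_taylor r * poly_taylor u) (poly_taylor b * poly_taylor s * poly_taylor u)"
    by (simp only: poly_taylor.eval_diff poly_taylor.eval_mult right_diff_distrib)
       (simp add: mult_ac Y.cong_def Y.zero_closed)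
  then have ar: "Y.cong (poly_taylor a * poly_taylor r) (poly_taylor b * poly_taylor s)"
    using u(1) poly_taylor_cancel by blast
  have "taylor g * poly_taylor s * poly_taylor r = taylor g * poly_taylor r * poly_taylor s"
    by (simp add: mult_ac)
  also have "Y.cong \<dots> (poly_taylor b * poly_taylor s)"
    by (rule Y.cong_mult[OF br(3) Y.cong_refl])
  also have "Y.cong \<dots> (poly_taylor a * poly_taylor r)" by (rule Y.cong_sym[OF ar])
  finally show ?thesis using br(1) poly_taylor_cancel by blast
qed

text \<open>A single fraction pins the expansion down, because its denominator can be cancelled. The
  rules for sums and products follow by naming the fraction.\<close>

lemma taylor_eqI:
  assumes "s \<notin> origin_ideal" "g * loc s = loc a" "Y.cong (t * poly_taylor s) (poly_taylor a)"
  shows "Y.cong (taylor g) t"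
  by (rule poly_taylor_cancel[OF assms(1)])
     (rule Y.cong_trans[OF taylor_times[OF assms(1,2)] Y.cong_sym[OF assms(3)]])

lemma taylor_loc: "Y.cong (taylor (loc p)) (poly_taylor p)"
  by (rule taylor_eqI[of 1 _ p])
     (simp_all add: one_notin_origin_ideal loc_one poly_taylor.eval_one Y.cong_refl)

lemma taylor_add: "Y.cong (taylor (g + h)) (taylor g + taylor h)"
proof -
  obtain a s where as: "s \<notin> origin_ideal" "g * loc s = loc a" by (rule loc_fraction)
  obtain b r where br: "r \<notin> origin_ideal" "h * loc r = loc b" by (rule loc_fraction)
  show ?thesis
  proof (rule taylor_eqI)
    show "s * r \<notin> origin_ideal" using as br by (simp add: mult_notin_origin_ideal)
    show "(g + h) * loc (s * r) = loc (a * r + b * s)"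
      unfolding loc_add loc_mult as(2)[symmetric] br(2)[symmetric]
      by (simp only: ring_distribs mult_ac)
    have "(taylor g + taylor h) * poly_taylor (s * r) =
        taylor g * poly_taylor s * poly_taylor r + taylor h * poly_taylor r * poly_taylor s"
      by (simp only: poly_taylor.eval_mult ring_distribs mult_ac)
    also have "Y.cong \<dots> (poly_taylor a * poly_taylor r + poly_taylor b * poly_taylor s)"
      by (intro Y.cong_add Y.cong_mult taylor_times as br Y.cong_refl)
    finally show "Y.cong ((taylor g + taylor h) * poly_taylor (s * r)) (poly_taylor (a * r + b * s))"
      by (simp add: poly_taylor.eval_mult poly_taylor.eval_add)
  qed
qed

lemma taylor_mult: "Y.cong (taylor (g * h)) (taylor g * taylor h)"
proof -
  obtain a s where as: "s \<notin> origin_ideal" "g * loc s = loc a" by (rule loc_fraction)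
  obtain b r where br: "r \<notin> origin_ideal" "h * loc r = loc b" by (rule loc_fraction)
  show ?thesis
  proof (rule taylor_eqI)
    show "s * r \<notin> origin_ideal" using as br by (simp add: mult_notin_origin_ideal)
    show "(g * h) * loc (s * r) = loc (a * b)"
      unfolding loc_mult as(2)[symmetric] br(2)[symmetric] by (simp add: mult_ac)
    have "(taylor g * taylor h) * poly_taylor (s * r) =
        (taylor g * poly_taylor s) * (taylor h * poly_taylor r)"
      by (simp add: poly_taylor.eval_mult mult_ac)
    also have "Y.cong \<dots> (poly_taylor a * poly_taylor b)"
      by (intro Y.cong_mult taylor_times as br)
    finally show "Y.cong ((taylor g * taylor h) * poly_taylor (s * r)) (poly_taylor (a * b))"
      by (simp add: poly_taylor.eval_mult)
  qed
qed

lemma taylor_loc_const: "Y.cong (taylor (loc_const c)) (const (loc_const c))"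
  using taylor_loc[of "const c"] by (simp add: loc_const_eq poly_taylor.eval_const)

lemma taylor_loc_var: "Y.cong (taylor (loc_var i)) (const (loc_var i) + yvar i)"
  using taylor_loc[of "yvar i"] by (simp add: loc_yvar poly_taylor.eval_var)

lemma taylor_one: "Y.cong (taylor 1) 1"
  using taylor_loc[of 1] by (simp add: loc_one poly_taylor.eval_one)

text \<open>Modulo positive degree the expansions of numerator and denominator are their values, and
  the value of the denominator is a unit. Positivity of n puts \<open>Y_ideal n\<close> into
  positive degree; \<open>Y_ideal 0\<close> contains everything.\<close>

lemma taylor_degree:
  fixes g :: "('n::finite, 'k::field) locpoly"
  assumes "n > 0"
  shows "taylor g - const g \<in> degree_ge 1"
proof -
  interpret D: type_ideal "degree_ge 1 :: (('n \<Rightarrow>\<^sub>0 nat) \<Rightarrow>\<^sub>0 ('n, 'k) locpoly) set"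
    by (rule type_ideal_degree_ge)
  obtain a s where as: "s \<notin> origin_ideal" "g * loc s = loc a" by (rule loc_fraction)
  obtain z where z: "loc s * z = 1" using as(1) by (rule loc_unit)
  have s: "D.cong (poly_taylor p) (const (loc p))" for p
    unfolding D.cong_def by (rule poly_taylor_degree)
  have a: "D.cong (taylor g * poly_taylor s) (poly_taylor a)"
    unfolding D.cong_def
    by (rule subsetD[OF Y_subset_degree_ge[OF assms] taylor_times[OF as, unfolded Y.cong_def]])
  have "taylor g * const (loc s) * const z = taylor g * const (loc s * z)"
    by (simp add: const_mult mult.assoc)
  then have "taylor g = taylor g * const (loc s) * const z" by (simp add: z)
  also have "D.cong \<dots> (taylor g * poly_taylor s * const z)"
    by (intro D.cong_mult D.cong_refl D.cong_sym[OF s])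
  also have "D.cong \<dots> (poly_taylor a * const z)"
    by (rule D.cong_mult[OF a D.cong_refl])
  also have "D.cong \<dots> (const (loc a) * const z)"
    by (intro D.cong_mult D.cong_refl s)
  also have "const (loc a) * const z = const g"
    unfolding const_mult[symmetric] as(2)[symmetric] mult.assoc z by simp
  finally show ?thesis unfolding D.cong_def .
qed

end


section \<open>Duality for the truncated diagonal\<close>

definition diag_var :: "'n \<Rightarrow> ('n, 'k::field) locpoly2"
  where "diag_var i = left_incl (loc_var i) - right_incl (loc_var i)"

definition diag_eval :: "(('n::finite \<Rightarrow>\<^sub>0 nat) \<Rightarrow>\<^sub>0 ('n, 'k::field) locpoly) \<Rightarrow> ('n, 'k) locpoly2"
  where "diag_eval = poly_eval right_incl diag_var"

interpretation diag_eval: eval_hom right_incl diag_var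
  rewrites "poly_eval right_incl diag_var = diag_eval"
  by unfold_locales
     (simp_all add: right_incl_add right_incl_mult right_incl_one diag_eval_def)

text \<open>The substitution turns x + y into right + (left - right) = left on each variable, and on
  scalars the two inclusions agree.\<close>

lemma diag_eval_poly_taylor: "diag_eval (poly_taylor p) = left_incl (loc p)"
proof (induction p rule: polynomial_induct)
  case (const c)
  show ?case
    by (simp add: poly_taylor.eval_const diag_eval.eval_const loc_const_eq left_incl_loc_const)
next
  case (var i)
  show ?case
    by (simp add: poly_taylor.eval_var diag_eval.eval_add diag_eval.eval_const diag_eval.eval_var
      diag_var_def loc_yvar)
next
  case (add p q)
  then show ?case
    by (simp add: poly_taylor.eval_add diag_eval.eval_add loc_add left_incl_add)
next
  case (mult p q)
  then show ?case
    by (simp add: poly_taylor.eval_mult diag_eval.eval_mult loc_mult left_incl_mult)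
qed

lemma diag_frob_eq: "diag_frob n = ideal_gen (range (\<lambda>i. diag_var i ^ n))"
  by (simp add: diag_frob_def diag_var_def)

lemma type_ideal_diag_frob: "type_ideal (diag_frob n)"
  unfolding diag_frob_def by (rule type_ideal_ideal_gen)

lemma type_ideal_ext_right: "type_ideal (ext_right J)"
  unfolding ext_right_def by (rule type_ideal_ideal_gen)

lemma type_ideal_ext_left: "type_ideal (ext_left J)"
  unfolding ext_left_def by (rule type_ideal_ideal_gen)

lemma right_incl_in_ext_right: "b \<in> J \<Longrightarrow> right_incl b \<in> ext_right J"
  unfolding ext_right_def using ideal_gen_superset[of "right_incl ` J"] by auto

lemma left_incl_in_ext_left: "b \<in> J \<Longrightarrow> left_incl b \<in> ext_left J"
  unfolding ext_left_def using ideal_gen_superset[of "left_incl ` J"] by auto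

lemma diag_eval_single_in_diag_frob:
  fixes c :: "('n::finite, 'k::field) locpoly"
  assumes "n \<le> Poly_Mapping.lookup m i"
  shows "diag_eval (Poly_Mapping.single m c) \<in> diag_frob n"
proof -
  interpret D: type_ideal "diag_frob n :: ('n, 'k) locpoly2 set" by (rule type_ideal_diag_frob)
  have "diag_var i ^ n \<in> (diag_frob n :: ('n, 'k) locpoly2 set)"
    unfolding diag_frob_eq using ideal_gen_superset[of "range (\<lambda>i. diag_var i ^ n)"] by auto
  then have "diag_var i ^ (Poly_Mapping.lookup m i - n) * diag_var i ^ n \<in> (diag_frob n :: ('n, 'k) locpoly2 set)"
    by (rule D.mult_closed_left)
  then have *: "diag_var i ^ Poly_Mapping.lookup m i \<in> (diag_frob n :: ('n, 'k) locpoly2 set)"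
    using assms by (simp flip: power_add)
  have "(\<Prod>j\<in>UNIV. (diag_var j :: ('n, 'k) locpoly2) ^ Poly_Mapping.lookup m j) =
      diag_var i ^ Poly_Mapping.lookup m i * (\<Prod>j\<in>UNIV - {i}. diag_var j ^ Poly_Mapping.lookup m j)"
    by (rule prod.remove) auto
  then show ?thesis
    unfolding diag_eval.eval_single by (simp only:) (intro D.mult_closed_left D.mult_closed_right *)
qed

lemma diag_eval_Y_ideal:
  fixes q :: "('n::finite \<Rightarrow>\<^sub>0 nat) \<Rightarrow>\<^sub>0 ('n, 'k::field) locpoly"
  assumes "q \<in> Y_ideal n"
  shows "diag_eval q \<in> diag_frob n"
proof -
  interpret D: type_ideal "diag_frob n :: ('n, 'k) locpoly2 set" by (rule type_ideal_diag_frob)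
  have "diag_eval q = (\<Sum>m\<in>Poly_Mapping.keys q. diag_eval (Poly_Mapping.single m (Poly_Mapping.lookup q m)))"
    unfolding diag_eval.eval_single by (simp add: diag_eval_def poly_eval_def)
  also have "\<dots> \<in> diag_frob n"
  proof (rule D.sum_closed)
    fix m assume "m \<in> Poly_Mapping.keys q"
    with assms obtain i where "n \<le> Poly_Mapping.lookup m i" by (auto simp: Y_ideal_def)
    then show "diag_eval (Poly_Mapping.single m (Poly_Mapping.lookup q m)) \<in> diag_frob n"
      by (rule diag_eval_single_in_diag_frob)
  qed
  finally show ?thesis .
qed

lemma yvar_power_in_Y: "(yvar i :: ('n \<Rightarrow>\<^sub>0 nat) \<Rightarrow>\<^sub>0 'a::comm_ring_1) ^ n \<in> Y_ideal n"
proof -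
  have "(yvar i :: ('n \<Rightarrow>\<^sub>0 nat) \<Rightarrow>\<^sub>0 'a::comm_ring_1) ^ k = Poly_Mapping.single (Poly_Mapping.single i k) 1" for k
    by (induction k) (simp_all add: yvar_def mult_single flip: single_add)
  then show ?thesis by (simp add: Y_ideal_def) (metis le_refl lookup_single_eq)
qed

section \<open>The isomorphism of P modulo \<open>diag_frob n\<close> with truncated polynomials
  over S\<close>

context
  fixes n :: nat
begin

interpretation Y: type_ideal "Y_ideal n :: (('n::finite \<Rightarrow>\<^sub>0 nat) \<Rightarrow>\<^sub>0 ('n, 'k::field) locpoly) set"
  by (rule type_ideal_Y)

interpretation D: type_ideal "diag_frob n :: ('n::finite, 'k::field) locpoly2 set"
  by (rule type_ideal_diag_frob)

text \<open>Both sides agree after multiplication by the unit \<open>left_incl (loc s)\<close>,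
  where the identity reduces to the exact one for polynomials.\<close>

lemma diag_eval_taylor: "D.cong (diag_eval (taylor n g)) (left_incl g)"
proof -
  obtain a s where as: "s \<notin> origin_ideal" "g * loc s = loc a" by (rule loc_fraction)
  obtain z where z: "loc s * z = 1" using as(1) by (rule loc_unit)
  have "diag_eval (taylor n g * poly_taylor s - poly_taylor a) \<in> diag_frob n"
    by (rule diag_eval_Y_ideal[OF taylor_times[OF as, of n, unfolded Y.cong_def]])
  also have "diag_eval (taylor n g * poly_taylor s - poly_taylor a) =
      (diag_eval (taylor n g) - left_incl g) * left_incl (loc s)"
    by (simp add: diag_eval.eval_diff diag_eval.eval_mult diag_eval_poly_taylor
      as(2)[symmetric] left_incl_mult left_diff_distrib)
  finally show ?thesis
    unfolding D.cong_def
    by (rule D.unit_cancel[where v = "left_incl z"])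
       (simp add: z left_incl_mult[symmetric] left_incl_one)
qed

interpretation B: bilinear_mod "Y_ideal n" "\<lambda>a b :: ('n::finite, 'k::field) locpoly. const b * taylor n a"
proof
  fix a a' b b' :: "('n, 'k) locpoly" and c
  have "Y.cong (const b * taylor n (a + a')) (const b * (taylor n a + taylor n a'))"
    by (intro Y.cong_mult Y.cong_refl taylor_add)
  then show "Y.cong (const b * taylor n (a + a')) (const b * taylor n a + const b * taylor n a')"
    by (simp only: distrib_left)
  show "Y.cong (const (b + b') * taylor n a) (const b * taylor n a + const b' * taylor n a)"
    by (simp add: single_add distrib_right Y.cong_refl)
  have "Y.cong (taylor n (loc_const c * a)) (taylor n (loc_const c) * taylor n a)"
    by (rule taylor_mult)
  also have "Y.cong \<dots> (const (loc_const c) * taylor n a)"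
    by (intro Y.cong_mult Y.cong_refl taylor_loc_const)
  finally have "Y.cong (const b * taylor n (loc_const c * a)) (const b * (const (loc_const c) * taylor n a))"
    by (rule Y.cong_mult[OF Y.cong_refl])
  then show "Y.cong (const b * taylor n (loc_const c * a)) (const (loc_const c * b) * taylor n a)"
    by (simp only: const_mult mult_ac)
qed

text \<open>The candidate inverse of \<open>diag_eval\<close>: the right factor becomes a
  coefficient and the left factor is expanded.\<close>

definition tensor_taylor :: "('n::finite, 'k::field) locpoly2 \<Rightarrow> ('n \<Rightarrow>\<^sub>0 nat) \<Rightarrow>\<^sub>0 ('n, 'k) locpoly"
  where "tensor_taylor = tensor_lift (\<lambda>a b. const b * taylor n a)"

lemma tensor_taylor_tensor: "Y.cong (tensor_taylor (tensor a b)) (const b * taylor n a)"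
  unfolding tensor_taylor_def by (rule B.lift_tensor)

lemma tensor_taylor_add: "Y.cong (tensor_taylor (v + w)) (tensor_taylor v + tensor_taylor w)"
  unfolding tensor_taylor_def by (rule B.lift_add)

lemma tensor_taylor_diff: "Y.cong (tensor_taylor (v - w)) (tensor_taylor v - tensor_taylor w)"
  unfolding tensor_taylor_def by (rule B.lift_diff)

lemma tensor_taylor_mult: "Y.cong (tensor_taylor (v * w)) (tensor_taylor v * tensor_taylor w)"
proof (induction v rule: tensor_induct)
  case (tensor a b)
  show ?case
  proof (induction w rule: tensor_induct)
    case (tensor a' b')
    have "Y.cong (tensor_taylor (tensor a b * tensor a' b')) (const (b * b') * taylor n (a * a'))"
      unfolding tensor_mult by (rule tensor_taylor_tensor)
    also have "Y.cong \<dots> (const (b * b') * (taylor n a * taylor n a'))"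
      by (intro Y.cong_mult Y.cong_refl taylor_mult)
    also have "\<dots> = (const b * taylor n a) * (const b' * taylor n a')"
      by (simp only: const_mult mult_ac)
    also have "Y.cong \<dots> (tensor_taylor (tensor a b) * tensor_taylor (tensor a' b'))"
      by (intro Y.cong_mult Y.cong_sym[OF tensor_taylor_tensor])
    finally show ?case .
  next
    case (diff v w)
    have "Y.cong (tensor_taylor (tensor a b * (v - w)))
        (tensor_taylor (tensor a b * v) - tensor_taylor (tensor a b * w))"
      unfolding right_diff_distrib by (rule tensor_taylor_diff)
    also have "Y.cong \<dots> (tensor_taylor (tensor a b) * tensor_taylor v - tensor_taylor (tensor a b) * tensor_taylor w)"
      by (intro Y.cong_diff diff)
    also have "\<dots> = tensor_taylor (tensor a b) * (tensor_taylor v - tensor_taylor w)"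
      by (simp only: right_diff_distrib)
    also have "Y.cong \<dots> (tensor_taylor (tensor a b) * tensor_taylor (v - w))"
      by (intro Y.cong_mult Y.cong_refl Y.cong_sym[OF tensor_taylor_diff])
    finally show ?case .
  qed
next
  case (diff u v)
  have "Y.cong (tensor_taylor ((u - v) * w)) (tensor_taylor (u * w) - tensor_taylor (v * w))"
    unfolding left_diff_distrib by (rule tensor_taylor_diff)
  also have "Y.cong \<dots> (tensor_taylor u * tensor_taylor w - tensor_taylor v * tensor_taylor w)"
    by (intro Y.cong_diff diff)
  also have "\<dots> = (tensor_taylor u - tensor_taylor v) * tensor_taylor w"
    by (simp only: left_diff_distrib)
  also have "Y.cong \<dots> (tensor_taylor (u - v) * tensor_taylor w)"
    by (intro Y.cong_mult Y.cong_refl Y.cong_sym[OF tensor_taylor_diff])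
  finally show ?case .
qed

lemma tensor_taylor_right: "Y.cong (tensor_taylor (right_incl b)) (const b)"
proof -
  have "Y.cong (tensor_taylor (right_incl b)) (const b * taylor n 1)"
    unfolding right_incl_def by (rule tensor_taylor_tensor)
  also have "Y.cong \<dots> (const b * 1)" by (intro Y.cong_mult Y.cong_refl taylor_one)
  finally show ?thesis by simp
qed

lemma tensor_taylor_left: "Y.cong (tensor_taylor (left_incl a)) (taylor n a)"
  using tensor_taylor_tensor[of a 1] by (simp add: left_incl_def)

lemma diag_eval_tensor_taylor: "D.cong (diag_eval (tensor_taylor w)) w"
proof (induction w rule: tensor_induct)
  case (tensor a b)
  have "diag_eval (tensor_taylor (tensor a b) - const b * taylor n a) \<in> diag_frob n"
    by (rule diag_eval_Y_ideal[OF tensor_taylor_tensor[unfolded Y.cong_def]])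
  then have "D.cong (diag_eval (tensor_taylor (tensor a b))) (right_incl b * diag_eval (taylor n a))"
    by (simp add: D.cong_def diag_eval.eval_diff diag_eval.eval_mult diag_eval.eval_const)
  also have "D.cong \<dots> (right_incl b * left_incl a)"
    by (intro D.cong_mult D.cong_refl diag_eval_taylor)
  also have "\<dots> = tensor a b" by (simp add: tensor_eq_incl mult.commute)
  finally show ?case .
next
  case (diff v w)
  have "diag_eval (tensor_taylor (v - w) - (tensor_taylor v - tensor_taylor w)) \<in> diag_frob n"
    by (rule diag_eval_Y_ideal[OF tensor_taylor_diff[unfolded Y.cong_def]])
  then have "D.cong (diag_eval (tensor_taylor (v - w))) (diag_eval (tensor_taylor v) - diag_eval (tensor_taylor w))"
    unfolding D.cong_def diag_eval.eval_diff .
  also have "D.cong \<dots> (v - w)" by (intro D.cong_diff diff)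
  finally show ?case .
qed

text \<open>Both maps are multiplicative up to congruence, so generators suffice; on a variable, the
  expansion x + y minus the constant x leaves y. With \<open>diag_eval_tensor_taylor\<close> this
  gives the isomorphism.\<close>

lemma tensor_taylor_diag_eval: "Y.cong (tensor_taylor (diag_eval q)) q"
proof (induction q rule: polynomial_induct)
  case (const c)
  show ?case unfolding diag_eval.eval_const by (rule tensor_taylor_right)
next
  case (var i)
  have "Y.cong (tensor_taylor (diag_var i)) (tensor_taylor (left_incl (loc_var i)) - tensor_taylor (right_incl (loc_var i)))"
    unfolding diag_var_def by (rule tensor_taylor_diff)
  also have "Y.cong \<dots> (taylor n (loc_var i) - const (loc_var i))"
    by (intro Y.cong_diff tensor_taylor_left tensor_taylor_right)
  also have "Y.cong \<dots> (const (loc_var i) + yvar i - const (loc_var i))"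
    by (intro Y.cong_diff taylor_loc_var Y.cong_refl)
  finally show ?case by (simp add: diag_eval.eval_var)
next
  case (add p q)
  show ?case unfolding diag_eval.eval_add
    by (rule Y.cong_trans[OF tensor_taylor_add Y.cong_add[OF add]])
next
  case (mult p q)
  show ?case unfolding diag_eval.eval_mult
    by (rule Y.cong_trans[OF tensor_taylor_mult Y.cong_mult[OF mult]])
qed

lemma tensor_taylor_diag_frob:
  assumes "w \<in> diag_frob n"
  shows "tensor_taylor w \<in> Y_ideal n"
proof -
  let ?T = "{w. tensor_taylor w \<in> Y_ideal n}"
  have "tensor_taylor 0 \<in> Y_ideal n"
    using tensor_taylor_diff[of 0 0] by (simp add: Y.cong_def)
  then have "type_ideal ?T"
    by (intro type_ideal.intro)
       (simp add: ideal_ring_of_type_iff Y.cong_mem_iff[OF tensor_taylor_add]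
         Y.cong_mem_iff[OF tensor_taylor_mult] Y.add_closed Y.mult_closed_left)
  then have "diag_frob n \<subseteq> ?T"
    unfolding diag_frob_eq
  proof (rule ideal_gen_subset)
    have "tensor_taylor (diag_var i ^ n) \<in> Y_ideal n" for i
      using Y.cong_mem_iff[OF tensor_taylor_diag_eval[of "yvar i ^ n"]]
      by (simp add: yvar_power_in_Y diag_eval.eval_power diag_eval.eval_var)
    then show "range (\<lambda>i. diag_var i ^ n) \<subseteq> ?T" by auto
  qed
  with assms show ?thesis by blast
qed

end


section \<open>Exponents below n, and the pairing given by the top coefficient\<close>

definition box :: "nat \<Rightarrow> ('n::finite \<Rightarrow>\<^sub>0 nat) set"
  where "box n = {a. \<forall>i. Poly_Mapping.lookup a i < n}"

text \<open>For positive n this is the largest exponent that survives modulo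
  \<open>Y_ideal n\<close>. At n = 0 the truncated subtraction still yields exponent 0 although
  \<open>box 0\<close> is empty, whence the assumption \<open>n > 0\<close> for the pairing.\<close>

definition top_exponent :: "nat \<Rightarrow> ('n::finite \<Rightarrow>\<^sub>0 nat)"
  where "top_exponent n = Abs_poly_mapping (\<lambda>_. n - 1)"

lemma lookup_top_exponent: "Poly_Mapping.lookup (top_exponent n) i = n - 1"
  by (simp add: top_exponent_def)

lemma finite_box: "finite (box n :: ('n::finite \<Rightarrow>\<^sub>0 nat) set)"
proof (rule finite_imageD)
  show "finite (Poly_Mapping.lookup ` (box n :: ('n \<Rightarrow>\<^sub>0 nat) set))"
    by (rule finite_subset[OF _ finite_PiE[of UNIV "\<lambda>_. {..<n}"]]) (auto simp: box_def)
  show "inj_on Poly_Mapping.lookup (box n :: ('n \<Rightarrow>\<^sub>0 nat) set)"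
    by (auto intro!: inj_onI poly_mapping_eqI)
qed

lemma top_exponent_split: "a \<in> box n \<Longrightarrow> (top_exponent n - a) + a = top_exponent n"
  by (rule poly_mapping_eqI)
     (simp add: lookup_add lookup_minus lookup_top_exponent box_def le_diff_conv2 Suc_le_eq)

lemma top_exponent_in_box: "n > 0 \<Longrightarrow> top_exponent n \<in> box n"
  by (simp add: box_def lookup_top_exponent)

lemma lookup_Y_ideal: "p \<in> Y_ideal n \<Longrightarrow> a \<in> box n \<Longrightarrow> Poly_Mapping.lookup p a = 0"
  by (auto simp: Y_ideal_def box_def in_keys_iff not_le[symmetric])

lemma lookup_single_times_top:
  fixes p :: "('n::finite \<Rightarrow>\<^sub>0 nat) \<Rightarrow>\<^sub>0 'a::comm_ring_1"
  shows
  "a \<in> box n \<Longrightarrow> Poly_Mapping.lookup (Poly_Mapping.single (top_exponent n - a) c * p) (top_exponent n) =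
    c * Poly_Mapping.lookup p a"
  using lookup_single_times[of "top_exponent n - a" c p a] by (simp add: top_exponent_split)

context
  fixes n :: nat
  assumes n_pos: "n > 0"
begin

interpretation Y: type_ideal "Y_ideal n :: (('n::finite \<Rightarrow>\<^sub>0 nat) \<Rightarrow>\<^sub>0 ('n, 'k::field) locpoly) set"
  by (rule type_ideal_Y)

interpretation D: type_ideal "diag_frob n :: ('n::finite, 'k::field) locpoly2 set"
  by (rule type_ideal_diag_frob)

text \<open>The coefficient of the top monomial generates the dual of \<open>P / \<Delta>\<^bsup>[n]\<^esup>\<close> over the right factor.\<close>

definition top_coeff :: "('n::finite, 'k::field) locpoly2 \<Rightarrow> ('n, 'k) locpoly"
  where "top_coeff w = Poly_Mapping.lookup (tensor_taylor n w) (top_exponent n)"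

lemma top_coeff_cong: "Y.cong (tensor_taylor n w) p \<Longrightarrow> top_coeff w = Poly_Mapping.lookup p (top_exponent n)"
  using lookup_Y_ideal[OF _ top_exponent_in_box[OF n_pos], of "tensor_taylor n w - p"]
  by (simp add: Y.cong_def top_coeff_def lookup_minus)

lemma top_coeff_add: "top_coeff (v + w) = top_coeff v + top_coeff w"
  using top_coeff_cong[OF tensor_taylor_add, of v w] by (simp add: lookup_add top_coeff_def)

lemma top_coeff_diff: "top_coeff (v - w) = top_coeff v - top_coeff w"
  using top_coeff_add[of "v - w" w] by simp

lemma top_coeff_zero: "top_coeff 0 = 0"
  using top_coeff_diff[of 0 0] by simp

lemma top_coeff_right: "top_coeff (right_incl b * w) = b * top_coeff w"
proof -
  have "Y.cong (tensor_taylor n (right_incl b * w)) (tensor_taylor n (right_incl b) * tensor_taylor n w)"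
    by (rule tensor_taylor_mult)
  also have "Y.cong \<dots> (const b * tensor_taylor n w)"
    by (intro Y.cong_mult Y.cong_refl tensor_taylor_right)
  finally show ?thesis
    using lookup_single_times[of 0 b "tensor_taylor n w" "top_exponent n"]
    by (simp add: top_coeff_cong) (simp add: top_coeff_def)
qed

lemma top_coeff_diag_frob: "w \<in> diag_frob n \<Longrightarrow> top_coeff w = 0"
  unfolding top_coeff_def by (rule lookup_Y_ideal[OF tensor_taylor_diag_frob top_exponent_in_box[OF n_pos]])

lemma top_coeff_ext_right:
  fixes J :: "('n::finite, 'k::field) locpoly set"
  assumes "type_ideal J" "w \<in> ideal_sum (ext_right J) (diag_frob n)"
  shows "top_coeff w \<in> J"
proof -
  interpret J: type_ideal J by (rule assms)
  \<comment> \<open>Quantifying over all multiples turns the condition into an ideal, so it can be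
    tested on generators.\<close>
  let ?T = "{w. \<forall>v. top_coeff (v * w) \<in> J}"
  have T: "type_ideal ?T"
    by (rule type_ideal.intro)
       (auto simp: ideal_ring_of_type_iff top_coeff_zero J.zero_closed distrib_left top_coeff_add
         J.add_closed mult.assoc[symmetric])
  have "ext_right J \<subseteq> ?T"
    unfolding ext_right_def
    by (rule ideal_gen_subset[OF T])
       (auto simp: mult.commute[of _ "right_incl _"] top_coeff_right J.mult_closed_right)
  moreover have "diag_frob n \<subseteq> ?T"
    by (auto simp: top_coeff_diag_frob D.mult_closed_left J.zero_closed)
  ultimately have "w \<in> ?T" using ideal_sum_minimal[OF T] assms(2) by blast
  then have "top_coeff (1 * w) \<in> J" by blast
  then show ?thesis by simp
qed

text \<open>Nondegeneracy of the pairing: multiplying by the monomial complementary to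
  \<open>a\<close> moves the coefficient at \<open>a\<close> to the top, so all coefficients of
  \<open>w\<close> in the box lie in \<open>J\<close>. The remaining monomials already belong to
  \<open>diag_frob n\<close>.\<close>

lemma mem_ext_right_of_top_coeff:
  fixes J :: "('n::finite, 'k::field) locpoly set"
  assumes "\<And>v. top_coeff (w * v) \<in> J"
  shows "w \<in> ideal_sum (ext_right J) (diag_frob n)"
proof -
  interpret S: type_ideal "ideal_sum (ext_right J) (diag_frob n)"
    by (rule type_ideal_ideal_sum[OF type_ideal_ext_right type_ideal_diag_frob])
  let ?p = "tensor_taylor n w"
  have box: "Poly_Mapping.lookup ?p a \<in> J" if a: "a \<in> box n" for a
  proof -
    let ?m = "Poly_Mapping.single (top_exponent n - a) 1"
    have "Y.cong (tensor_taylor n (w * diag_eval ?m)) (?p * tensor_taylor n (diag_eval ?m))"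
      by (rule tensor_taylor_mult)
    also have "Y.cong \<dots> (?p * ?m)"
      by (intro Y.cong_mult Y.cong_refl tensor_taylor_diag_eval)
    also have "?p * ?m = ?m * ?p" by (rule mult.commute)
    finally have "top_coeff (w * diag_eval ?m) = Poly_Mapping.lookup ?p a"
      by (simp add: top_coeff_cong lookup_single_times_top[OF a])
    with assms show ?thesis by metis
  qed
  have "diag_eval ?p = (\<Sum>m\<in>Poly_Mapping.keys ?p. diag_eval (Poly_Mapping.single m (Poly_Mapping.lookup ?p m)))"
    unfolding diag_eval.eval_single by (simp add: diag_eval_def poly_eval_def)
  also have "\<dots> \<in> ideal_sum (ext_right J) (diag_frob n)"
  proof (rule S.sum_closed)
    fix m
    show "diag_eval (Poly_Mapping.single m (Poly_Mapping.lookup ?p m)) \<in> ideal_sum (ext_right J) (diag_frob n)"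
    proof (cases "m \<in> box n")
      case True
      then have "right_incl (Poly_Mapping.lookup ?p m) \<in> ideal_sum (ext_right J) (diag_frob n)"
        by (intro ideal_sum_left type_ideal_diag_frob right_incl_in_ext_right box)
      then show ?thesis unfolding diag_eval.eval_single by (rule S.mult_closed_right)
    next
      case False
      then obtain i where "n \<le> Poly_Mapping.lookup m i" by (auto simp: box_def not_less)
      then show ?thesis
        by (intro ideal_sum_right type_ideal_ext_right diag_eval_single_in_diag_frob)
    qed
  qed
  finally have "diag_eval ?p \<in> ideal_sum (ext_right J) (diag_frob n)" .
  moreover have "diag_eval ?p - w \<in> ideal_sum (ext_right J) (diag_frob n)"
    by (intro ideal_sum_right type_ideal_ext_right diag_eval_tensor_taylor[of n w, unfolded D.cong_def])
  ultimately show ?thesis using S.cong_mem_iff[of "diag_eval ?p" w] by (simp add: S.cong_def)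
qed

text \<open>Coefficients of the functional on the monomials \<open>y\<^sup>a\<close>, placed at the complementary
  exponents, give the element that represents it.\<close>

lemma top_coeff_represents:
  fixes J :: "('n::finite, 'k::field) locpoly set"
    and \<psi> :: "('n, 'k) locpoly2 \<Rightarrow> ('n, 'k) locpoly"
  assumes "type_ideal J"
    and add: "\<And>v w. type_ideal.cong J (\<psi> (v + w)) (\<psi> v + \<psi> w)"
    and right: "\<And>b w. type_ideal.cong J (\<psi> (right_incl b * w)) (b * \<psi> w)"
    and frob: "\<And>w. w \<in> diag_frob n \<Longrightarrow> \<psi> w \<in> J"
  obtains u where "\<And>w. type_ideal.cong J (top_coeff (u * w)) (\<psi> w)"
proof -
  interpret J: type_ideal J by (rule assms)
  define e where "e a = \<psi> (diag_eval (Poly_Mapping.single a 1))" for a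
  define q where "q = (\<Sum>a\<in>box n. Poly_Mapping.single (top_exponent n - a) (e a))"
  \<comment> \<open>Linearity over the right factor reduces the functional to its values on
    monomials; those outside the box are killed by \<open>frob\<close>.\<close>
  have e: "J.cong (\<psi> (diag_eval p)) (\<Sum>a\<in>box n. e a * Poly_Mapping.lookup p a)" for p
  proof (induction p rule: poly_mapping_additive_induct)
    case (single m c)
    have split: "diag_eval (Poly_Mapping.single m c) = right_incl c * diag_eval (Poly_Mapping.single m 1)"
      by (simp add: diag_eval.eval_single right_incl_one)
    have sum: "(\<Sum>a\<in>box n. e a * Poly_Mapping.lookup (Poly_Mapping.single m c) a) =
        (if m \<in> box n then c * e m else 0)"
      by (simp add: lookup_single when_def finite_box if_distrib[of "(*) _"] mult.commute cong: if_cong)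
    show ?case
    proof (cases "m \<in> box n")
      case True
      then show ?thesis using right[of c "diag_eval (Poly_Mapping.single m 1)", folded e_def]
        by (simp only: split sum if_True)
    next
      case False
      then obtain i where "n \<le> Poly_Mapping.lookup m i" by (auto simp: box_def not_less)
      then have "\<psi> (diag_eval (Poly_Mapping.single m c)) \<in> J"
        by (intro frob diag_eval_single_in_diag_frob)
      with False show ?thesis by (simp only: sum if_False J.cong_zero_iff)
    qed
  next
    case (add p q)
    have "J.cong (\<psi> (diag_eval (p + q))) (\<psi> (diag_eval p) + \<psi> (diag_eval q))"
      unfolding diag_eval.eval_add by (rule assms(2))
    also have "J.cong \<dots> ((\<Sum>a\<in>box n. e a * Poly_Mapping.lookup p a) + (\<Sum>a\<in>box n. e a * Poly_Mapping.lookup q a))"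
      by (intro J.cong_add add)
    finally show ?case by (simp add: lookup_add distrib_left sum.distrib)
  qed
  have "J.cong (top_coeff (diag_eval q * w)) (\<psi> w)" for w
  proof -
    let ?p = "tensor_taylor n w"
    have "Y.cong (tensor_taylor n (diag_eval q * w)) (tensor_taylor n (diag_eval q) * ?p)"
      by (rule tensor_taylor_mult)
    also have "Y.cong \<dots> (q * ?p)" by (intro Y.cong_mult Y.cong_refl tensor_taylor_diag_eval)
    finally have "top_coeff (diag_eval q * w) = Poly_Mapping.lookup (q * ?p) (top_exponent n)"
      by (rule top_coeff_cong)
    also have "\<dots> = (\<Sum>a\<in>box n. e a * Poly_Mapping.lookup ?p a)"
      by (simp add: q_def sum_distrib_right lookup_sum lookup_single_times_top)
    also have "J.cong \<dots> (\<psi> (diag_eval ?p))" by (rule J.cong_sym[OF e])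
    also have "J.cong \<dots> (\<psi> w)"
    proof -
      have "J.cong (\<psi> (diag_eval ?p - w + w)) (\<psi> (diag_eval ?p - w) + \<psi> w)" by (rule add)
      also have "J.cong \<dots> (0 + \<psi> w)"
        using frob[OF diag_eval_tensor_taylor[of n w, unfolded D.cong_def]]
        by (intro J.cong_add J.cong_refl) (simp add: J.cong_zero_iff)
      finally show ?thesis by simp
    qed
    finally show ?thesis .
  qed
  then show thesis by (rule that)
qed

end


section \<open>Differential operators modulo an ideal\<close>

text \<open>Operators on \<open>A / I\<close> are represented by functions on \<open>A\<close> that satisfy the defining
  identities modulo \<open>I\<close>; \<open>C\<close> is the set of scalars.\<close>

locale lifted_ops = type_ideal I for I :: "'a::comm_ring_1 set" +
  fixes C :: "'a set"
begin

notation cong (infix "\<approx>" 50)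

text \<open>The clause on \<open>I\<close> expresses that the induced map on the quotient is well
  defined.\<close>

definition linear_mod :: "'a set \<Rightarrow> ('a \<Rightarrow> 'a) \<Rightarrow> bool"
  where "linear_mod D \<delta> \<longleftrightarrow> (\<forall>x y. \<delta> (x + y) \<approx> \<delta> x + \<delta> y) \<and>
    (\<forall>c\<in>D. \<forall>x. \<delta> (c * x) \<approx> c * \<delta> x) \<and> (\<forall>x\<in>I. \<delta> x \<in> I)"

primrec dop :: "nat \<Rightarrow> ('a \<Rightarrow> 'a) \<Rightarrow> bool" where
  "dop 0 \<delta> = linear_mod UNIV \<delta>"
| "dop (Suc n) \<delta> = (linear_mod C \<delta> \<and> (\<forall>r. dop n (\<lambda>x. \<delta> (r * x) - r * \<delta> x)))"

lemma linear_mod_subset: "linear_mod UNIV \<delta> \<Longrightarrow> linear_mod D \<delta>"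
  by (simp add: linear_mod_def)

lemma dop_linear: "dop n \<delta> \<Longrightarrow> linear_mod C \<delta>"
  by (cases n) (auto simp: linear_mod_subset)

lemma linear_mod_cong:
  assumes \<delta>: "linear_mod D \<delta>" and eq: "\<And>x. \<delta> x \<approx> \<epsilon> x"
  shows "linear_mod D \<epsilon>"
  unfolding linear_mod_def
proof (intro conjI allI ballI)
  fix x y
  have "\<epsilon> (x + y) \<approx> \<delta> (x + y)" by (rule cong_sym[OF eq])
  also have "\<dots> \<approx> \<delta> x + \<delta> y" using \<delta> by (simp add: linear_mod_def)
  also have "\<dots> \<approx> \<epsilon> x + \<epsilon> y" by (intro cong_add eq)
  finally show "\<epsilon> (x + y) \<approx> \<epsilon> x + \<epsilon> y" .
next
  fix c x assume c: "c \<in> D"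
  have "\<epsilon> (c * x) \<approx> \<delta> (c * x)" by (rule cong_sym[OF eq])
  also have "\<dots> \<approx> c * \<delta> x" using \<delta> c by (simp add: linear_mod_def)
  also have "\<dots> \<approx> c * \<epsilon> x" by (intro cong_mult cong_refl eq)
  finally show "\<epsilon> (c * x) \<approx> c * \<epsilon> x" .
next
  fix x assume "x \<in> I"
  then show "\<epsilon> x \<in> I" using \<delta> cong_mem_iff[OF eq] by (simp add: linear_mod_def)
qed

lemma dop_cong: "dop n \<delta> \<Longrightarrow> (\<And>x. \<delta> x \<approx> \<epsilon> x) \<Longrightarrow> dop n \<epsilon>"
proof (induction n arbitrary: \<delta> \<epsilon>)
  case 0
  then show ?case using linear_mod_cong by simp
next
  case (Suc n)
  have "dop n (\<lambda>x. \<epsilon> (r * x) - r * \<epsilon> x)" for r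
  proof (rule Suc.IH)
    show "dop n (\<lambda>x. \<delta> (r * x) - r * \<delta> x)" using Suc.prems by simp
    show "\<delta> (r * x) - r * \<delta> x \<approx> \<epsilon> (r * x) - r * \<epsilon> x" for x
      by (intro cong_diff cong_mult cong_refl Suc.prems)
  qed
  moreover have "linear_mod C \<epsilon>" using Suc.prems linear_mod_cong by (metis dop.simps(2))
  ultimately show ?case by simp
qed

lemma linear_mod_add:
  assumes "linear_mod D \<delta>" "linear_mod D \<epsilon>"
  shows "linear_mod D (\<lambda>x. \<delta> x + \<epsilon> x)"
  unfolding linear_mod_def
proof (intro conjI allI ballI)
  fix x y
  have "\<delta> (x + y) + \<epsilon> (x + y) \<approx> (\<delta> x + \<delta> y) + (\<epsilon> x + \<epsilon> y)"
    using assms by (intro cong_add) (simp_all add: linear_mod_def)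
  then show "\<delta> (x + y) + \<epsilon> (x + y) \<approx> (\<delta> x + \<epsilon> x) + (\<delta> y + \<epsilon> y)"
    by (simp add: algebra_simps)
next
  fix c x assume "c \<in> D"
  then have "\<delta> (c * x) + \<epsilon> (c * x) \<approx> c * \<delta> x + c * \<epsilon> x"
    using assms by (intro cong_add) (simp_all add: linear_mod_def)
  then show "\<delta> (c * x) + \<epsilon> (c * x) \<approx> c * (\<delta> x + \<epsilon> x)"
    by (simp add: distrib_left)
qed (use assms in \<open>simp add: linear_mod_def add_closed\<close>)

lemma dop_add: "dop n \<delta> \<Longrightarrow> dop n \<epsilon> \<Longrightarrow> dop n (\<lambda>x. \<delta> x + \<epsilon> x)"
proof (induction n arbitrary: \<delta> \<epsilon>)
  case (Suc n)
  have "dop n (\<lambda>x. (\<delta> (r * x) + \<epsilon> (r * x)) - r * (\<delta> x + \<epsilon> x))" for r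
  proof -
    have "dop n (\<lambda>x. (\<delta> (r * x) - r * \<delta> x) + (\<epsilon> (r * x) - r * \<epsilon> x))"
      using Suc by simp
    then show ?thesis by (simp add: algebra_simps)
  qed
  then show ?case using Suc.prems by (simp add: linear_mod_add)
qed (simp add: linear_mod_add)

lemma linear_mod_smult:
  assumes "linear_mod D \<delta>"
  shows "linear_mod D (\<lambda>x. s * \<delta> x)"
  unfolding linear_mod_def
proof (intro conjI allI ballI)
  fix x y
  have "s * \<delta> (x + y) \<approx> s * (\<delta> x + \<delta> y)"
    using assms by (intro cong_mult cong_refl) (simp add: linear_mod_def)
  then show "s * \<delta> (x + y) \<approx> s * \<delta> x + s * \<delta> y" by (simp add: distrib_left)
next
  fix c x assume "c \<in> D"
  then have "s * \<delta> (c * x) \<approx> s * (c * \<delta> x)"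
    using assms by (intro cong_mult cong_refl) (simp add: linear_mod_def)
  then show "s * \<delta> (c * x) \<approx> c * (s * \<delta> x)" by (simp add: mult.left_commute)
qed (use assms in \<open>simp add: linear_mod_def mult_closed_left\<close>)

lemma dop_smult: "dop n \<delta> \<Longrightarrow> dop n (\<lambda>x. s * \<delta> x)"
proof (induction n arbitrary: \<delta>)
  case (Suc n)
  have "dop n (\<lambda>x. s * \<delta> (r * x) - r * (s * \<delta> x))" for r
  proof -
    have "dop n (\<lambda>x. s * (\<delta> (r * x) - r * \<delta> x))" using Suc by simp
    then show ?thesis by (simp add: right_diff_distrib mult.left_commute)
  qed
  then show ?case using Suc.prems by (simp add: linear_mod_smult)
qed (simp add: linear_mod_smult)

lemma linear_mod_valued_in_ideal: "(\<And>x. \<delta> x \<in> I) \<Longrightarrow> linear_mod D \<delta>"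
  by (simp add: linear_mod_def cong_def diff_closed add_closed mult_closed_left)

lemma dop_valued_in_ideal: "(\<And>x. \<delta> x \<in> I) \<Longrightarrow> dop n \<delta>"
proof (induction n arbitrary: \<delta>)
  case (Suc n)
  have "dop n (\<lambda>x. \<delta> (r * x) - r * \<delta> x)" for r
    by (rule Suc.IH) (intro diff_closed mult_closed_left Suc.prems)
  then show ?case using Suc.prems by (simp add: linear_mod_valued_in_ideal)
qed (simp add: linear_mod_valued_in_ideal)

lemma commutator_order_zero: "dop 0 \<delta> \<Longrightarrow> \<delta> (r * x) - r * \<delta> x \<in> I"
  by (simp add: linear_mod_def cong_def)

lemma dop_Suc: "dop n \<delta> \<Longrightarrow> dop (Suc n) \<delta>"
proof (induction n arbitrary: \<delta>)
  case 0
  have "dop 0 (\<lambda>x. \<delta> (r * x) - r * \<delta> x)" for r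
    by (rule dop_valued_in_ideal) (rule commutator_order_zero[OF 0])
  with dop_linear[OF 0] show ?case by simp
next
  case (Suc n)
  have "dop (Suc n) (\<lambda>x. \<delta> (r * x) - r * \<delta> x)" for r
    by (rule Suc.IH) (use Suc.prems in simp)
  with dop_linear[OF Suc.prems] show ?case
    unfolding dop.simps(2)[of "Suc n"] by blast
qed

lemma dop_mono: "dop m \<delta> \<Longrightarrow> m \<le> n \<Longrightarrow> dop n \<delta>"
  by (induction n) (auto simp: le_Suc_eq dop_Suc simp del: dop.simps)

lemma linear_mod_comp:
  assumes "linear_mod D \<delta>" "linear_mod D \<epsilon>"
  shows "linear_mod D (\<lambda>x. \<delta> (\<epsilon> x))"
proof -
  have cong: "\<delta> x \<approx> \<delta> y" if "x \<approx> y" for x y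
  proof -
    have "\<delta> ((x - y) + y) \<approx> \<delta> (x - y) + \<delta> y" using assms unfolding linear_mod_def by blast
    also have "\<dots> \<approx> 0 + \<delta> y"
      using assms that by (intro cong_add cong_refl) (simp add: linear_mod_def cong_zero_iff, simp add: cong_def)
    finally show ?thesis by simp
  qed
  show ?thesis
    unfolding linear_mod_def
  proof (intro conjI allI ballI)
    fix x y
    have "\<delta> (\<epsilon> (x + y)) \<approx> \<delta> (\<epsilon> x + \<epsilon> y)" using assms by (intro cong) (simp add: linear_mod_def)
    also have "\<dots> \<approx> \<delta> (\<epsilon> x) + \<delta> (\<epsilon> y)" using assms by (simp add: linear_mod_def)
    finally show "\<delta> (\<epsilon> (x + y)) \<approx> \<delta> (\<epsilon> x) + \<delta> (\<epsilon> y)" .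
  next
    fix c x assume c: "c \<in> D"
    have "\<delta> (\<epsilon> (c * x)) \<approx> \<delta> (c * \<epsilon> x)" using assms c by (intro cong) (simp add: linear_mod_def)
    also have "\<dots> \<approx> c * \<delta> (\<epsilon> x)" using assms c by (simp add: linear_mod_def)
    finally show "\<delta> (\<epsilon> (c * x)) \<approx> c * \<delta> (\<epsilon> x)" .
  qed (use assms in \<open>simp add: linear_mod_def\<close>)
qed

text \<open>Leibniz rule: \<open>[\<delta>\<epsilon>, r] = \<delta>[\<epsilon>, r] +
  [\<delta>, r]\<epsilon>\<close>, by induction on the total order. If one factor has order 0, its
  commutator takes values in \<open>I\<close> and that summand vanishes modulo
  \<open>I\<close>.\<close>

lemma dop_comp_aux: "dop m \<delta> \<Longrightarrow> dop n \<epsilon> \<Longrightarrow> m + n = k \<Longrightarrow> dop k (\<lambda>x. \<delta> (\<epsilon> x))"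
proof (induction k arbitrary: m n \<delta> \<epsilon>)
  case 0
  then show ?case by (simp add: linear_mod_comp)
next
  case (Suc k)
  have lin: "linear_mod C \<delta>" using Suc.prems(1) by (rule dop_linear)
  have "dop k (\<lambda>x. \<delta> (\<epsilon> (r * x)) - r * \<delta> (\<epsilon> x))" for r
  proof (rule dop_cong)
    have "dop k (\<lambda>x. \<delta> (\<epsilon> (r * x) - r * \<epsilon> x))"
    proof (cases n)
      case 0
      then show ?thesis
        using lin Suc.prems(2) commutator_order_zero
        by (intro dop_valued_in_ideal) (simp add: linear_mod_def[of C])
    next
      case (Suc n')
      then show ?thesis
        using Suc.prems by (intro Suc.IH[of m _ n']) simp_all
    qed
    moreover have "dop k (\<lambda>x. \<delta> (r * \<epsilon> x) - r * \<delta> (\<epsilon> x))"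
    proof (cases m)
      case 0
      then show ?thesis
        using Suc.prems(1) commutator_order_zero by (intro dop_valued_in_ideal) simp
    next
      case (Suc m')
      then show ?thesis
        using Suc.prems Suc.IH[of m' "\<lambda>x. \<delta> (r * x) - r * \<delta> x" n \<epsilon>] by simp
    qed
    ultimately show "dop k (\<lambda>x. \<delta> (\<epsilon> (r * x) - r * \<epsilon> x) + (\<delta> (r * \<epsilon> x) - r * \<delta> (\<epsilon> x)))"
      by (rule dop_add)
  next
    fix x
    have "\<delta> ((\<epsilon> (r * x) - r * \<epsilon> x) + r * \<epsilon> x) \<approx> \<delta> (\<epsilon> (r * x) - r * \<epsilon> x) + \<delta> (r * \<epsilon> x)"
      using lin unfolding linear_mod_def by blast
    then have "\<delta> (\<epsilon> (r * x)) - r * \<delta> (\<epsilon> x) \<approx>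
        \<delta> (\<epsilon> (r * x) - r * \<epsilon> x) + \<delta> (r * \<epsilon> x) - r * \<delta> (\<epsilon> x)"
      by (intro cong_diff cong_refl) simp
    from cong_sym[OF this]
    show "\<delta> (\<epsilon> (r * x) - r * \<epsilon> x) + (\<delta> (r * \<epsilon> x) - r * \<delta> (\<epsilon> x)) \<approx>
        \<delta> (\<epsilon> (r * x)) - r * \<delta> (\<epsilon> x)"
      by (simp only: add_diff_eq)
  qed
  then show ?case
    using linear_mod_comp[OF lin dop_linear[OF Suc.prems(2)]] by simp
qed

lemma dop_comp: "dop m \<delta> \<Longrightarrow> dop n \<epsilon> \<Longrightarrow> dop (m + n) (\<lambda>x. \<delta> (\<epsilon> x))"
  using dop_comp_aux by blast

lemma dop_zero: "dop 0 (\<lambda>_. 0)"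
  by (rule dop_valued_in_ideal) (rule zero_closed)

lemma dop_id: "dop 0 (\<lambda>x. x)"
  by (simp add: linear_mod_def cong_refl)

text \<open>The preimage in the ring of the D-submodule generated by the coset of \<open>f\<close>.
  Sums and multiples of operators make it an ideal, compositions make it stable.\<close>

definition orbit :: "'a \<Rightarrow> 'a set"
  where "orbit f = {h. \<exists>n \<delta>. dop n \<delta> \<and> h = \<delta> f}"

lemma orbitI: "dop n \<delta> \<Longrightarrow> \<delta> f \<in> orbit f"
  unfolding orbit_def by blast

lemma orbitE:
  assumes "h \<in> orbit f"
  obtains n \<delta> where "dop n \<delta>" "h = \<delta> f"
  using assms unfolding orbit_def by blast

lemma type_ideal_orbit: "type_ideal (orbit f)"
proof (rule type_ideal.intro, unfold ideal_ring_of_type_iff, intro conjI ballI allI)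
  show "0 \<in> orbit f" using orbitI[OF dop_zero] .
next
  fix x y assume "x \<in> orbit f" "y \<in> orbit f"
  then obtain m n \<delta> \<epsilon> where *: "dop m \<delta>" "x = \<delta> f" "dop n \<epsilon>" "y = \<epsilon> f"
    by (auto elim!: orbitE simp del: dop.simps)
  have "dop (max m n) (\<lambda>g. \<delta> g + \<epsilon> g)"
    by (intro dop_add dop_mono[OF *(1)] dop_mono[OF *(3)]) simp_all
  from orbitI[OF this, of f] show "x + y \<in> orbit f" by (simp add: *)
next
  fix x r assume "x \<in> orbit f"
  then obtain n \<delta> where *: "dop n \<delta>" "x = \<delta> f" by (rule orbitE)
  from orbitI[OF dop_smult[OF *(1)], of r f] show "r * x \<in> orbit f" by (simp add: *)
qed

section \<open>Descent to the carrier-based quotient ring\<close>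

abbreviation coset :: "'a \<Rightarrow> 'a set"
  where "coset g \<equiv> I +>\<^bsub>ring_of_type_algebra\<^esub> g"

abbreviation Q :: "'a set ring"
  where "Q \<equiv> ring_of_type_algebra Quot I"

lemma coset_eq: "coset g = {h + g | h. h \<in> I}"
  by (auto simp: a_r_coset_def r_coset_def ring_of_type_algebra_def)

lemma coset_eq_iff: "coset g = coset h \<longleftrightarrow> g \<approx> h"
proof
  assume "coset g = coset h"
  moreover have "g \<in> coset g" unfolding coset_eq using zero_closed by force
  ultimately obtain a where "a \<in> I" "g = a + h" unfolding coset_eq by auto
  then show "g \<approx> h" by (simp add: cong_def)
next
  have "coset x \<subseteq> coset y" if "x \<approx> y" for x y
  proof
    fix z assume "z \<in> coset x"
    then obtain a where a: "a \<in> I" "z = a + x" unfolding coset_eq by blast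
    then have "z = (a + (x - y)) + y" "a + (x - y) \<in> I"
      using that by (simp_all add: cong_def add_closed)
    then show "z \<in> coset y" unfolding coset_eq by blast
  qed
  then show "g \<approx> h \<Longrightarrow> coset g = coset h" using cong_sym by blast
qed

lemma ring_Q: "ring Q"
  by (rule ideal.quotient_is_ring[OF ideal_J])

lemma carrier_Q: "carrier Q = range coset"
  by (auto simp: FactRing_def A_RCOSETS_def' ring_of_type_algebra_def)

lemma zero_Q: "\<zero>\<^bsub>Q\<^esub> = coset 0"
  by (simp add: FactRing_def coset_eq)

lemma one_Q: "\<one>\<^bsub>Q\<^esub> = coset 1"
  by (simp add: FactRing_def ring_of_type_algebra_def)

lemma mult_Q: "coset g \<otimes>\<^bsub>Q\<^esub> coset h = coset (g * h)"
  using ideal.rcoset_mult_add[OF ideal_J, of g h]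
  by (simp add: FactRing_def ring_of_type_algebra_def)

lemma add_Q: "coset g \<oplus>\<^bsub>Q\<^esub> coset h = coset (g + h)"
proof -
  have "coset g \<oplus>\<^bsub>Q\<^esub> coset h = {x + y | x y. x \<in> coset g \<and> y \<in> coset h}"
    by (auto simp: FactRing_def set_add_def set_mult_def ring_of_type_algebra_def)
  also have "\<dots> = coset (g + h)"
  proof (intro equalityI subsetI)
    fix z assume "z \<in> {x + y | x y. x \<in> coset g \<and> y \<in> coset h}"
    then obtain a b where "a \<in> I" "b \<in> I" "z = (a + g) + (b + h)" unfolding coset_eq by blast
    then have "z = (a + b) + (g + h)" "a + b \<in> I" by (simp_all add: add_closed)
    then show "z \<in> coset (g + h)" unfolding coset_eq by blast
  next
    fix z assume "z \<in> coset (g + h)"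
    then obtain a where "a \<in> I" "z = (a + g) + (0 + h)" unfolding coset_eq by (auto simp: add.assoc)
    then show "z \<in> {x + y | x y. x \<in> coset g \<and> y \<in> coset h}"
      unfolding coset_eq using zero_closed by blast
  qed
  finally show ?thesis .
qed

lemma diff_Q: "coset g \<ominus>\<^bsub>Q\<^esub> coset h = coset (g - h)"
proof -
  interpret Q: ring Q by (rule ring_Q)
  have mem: "coset x \<in> carrier Q" for x by (simp add: carrier_Q)
  have "coset h \<oplus>\<^bsub>Q\<^esub> coset (- h) = \<zero>\<^bsub>Q\<^esub>" by (simp add: add_Q zero_Q)
  then have "\<ominus>\<^bsub>Q\<^esub> coset h = coset (- h)"
    using Q.minus_equality[of "coset (- h)" "coset h"] mem by (simp add: Q.a_comm)
  then show ?thesis by (simp add: a_minus_def add_Q)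
qed

definition lifts :: "('a \<Rightarrow> 'a) \<Rightarrow> ('a set \<Rightarrow> 'a set) \<Rightarrow> bool"
  where "lifts \<epsilon> \<delta> \<longleftrightarrow> \<delta> \<in> extensional (carrier Q) \<and> (\<forall>g. \<delta> (coset g) = coset (\<epsilon> g))"

lemma lifts_hom_over:
  assumes "lifts \<epsilon> \<delta>"
  shows "\<delta> \<in> hom_over (coset ` D) Q \<longleftrightarrow> linear_mod D \<epsilon>"
proof -
  have *: "\<delta> (coset g) = coset (\<epsilon> g)" for g using assms by (simp add: lifts_def)
  have "\<delta> \<in> carrier Q \<rightarrow>\<^sub>E carrier Q"
    using assms by (auto simp: PiE_iff carrier_Q lifts_def)
  then have "\<delta> \<in> hom_over (coset ` D) Q \<longleftrightarrow>
      (\<forall>x y. \<epsilon> (x + y) \<approx> \<epsilon> x + \<epsilon> y) \<and> (\<forall>c\<in>D. \<forall>x. \<epsilon> (c * x) \<approx> c * \<epsilon> x)"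
    by (simp add: hom_over_def carrier_Q add_Q mult_Q * coset_eq_iff)
  \<comment> \<open>Additivity at 0 puts \<open>\<epsilon> 0\<close> into \<open>I\<close>. An
    element of \<open>I\<close> has the same coset as 0, and a lift respects equality of
    cosets.\<close>
  moreover have "\<epsilon> x \<in> I" if add: "\<forall>x y. \<epsilon> (x + y) \<approx> \<epsilon> x + \<epsilon> y" and x: "x \<in> I" for x
  proof -
    have "\<epsilon> 0 \<in> I" using add[rule_format, of 0 0] uminus_closed by (fastforce simp: cong_def)
    moreover have "coset x = coset 0" using x by (simp add: coset_eq_iff cong_def)
    then have "\<epsilon> x \<approx> \<epsilon> 0" using * by (metis coset_eq_iff)
    ultimately show ?thesis using cong_mem_iff by blast
  qed
  ultimately show ?thesis unfolding linear_mod_def by blast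
qed

text \<open>The commutator of a lift is a lift of the commutator, so the two hierarchies of
  operators agree order by order.\<close>

lemma lifts_diff_ops_order:
  "lifts \<epsilon> \<delta> \<Longrightarrow> \<delta> \<in> diff_ops_order (coset ` C) Q n \<longleftrightarrow> dop n \<epsilon>"
proof (induction n arbitrary: \<epsilon> \<delta>)
  case 0
  then show ?case using lifts_hom_over[OF 0, of UNIV] by (simp add: carrier_Q)
next
  case (Suc n)
  have "commutator Q \<delta> (coset r) \<in> diff_ops_order (coset ` C) Q n \<longleftrightarrow>
      dop n (\<lambda>x. \<epsilon> (r * x) - r * \<epsilon> x)" for r
  proof (rule Suc.IH)
    show "lifts (\<lambda>x. \<epsilon> (r * x) - r * \<epsilon> x) (commutator Q \<delta> (coset r))"
      using Suc.prems by (simp add: lifts_def commutator_def carrier_Q mult_Q diff_Q)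
  qed
  then show ?case using lifts_hom_over[OF Suc.prems, of C] by (simp add: carrier_Q)
qed

lemma dop_descends:
  assumes "dop n \<epsilon>"
  obtains \<delta> where "lifts \<epsilon> \<delta>" "\<delta> \<in> diff_ops (coset ` C) Q"
proof -
  have lin: "linear_mod C \<epsilon>" using assms by (rule dop_linear)
  define \<delta> where "\<delta> = (\<lambda>U\<in>carrier Q. coset (\<epsilon> (SOME g. U = coset g)))"
  have "\<delta> (coset g) = coset (\<epsilon> g)" for g
  proof -
    define h where "h = (SOME h. coset g = coset h)"
    have "coset g = coset h" unfolding h_def by (rule someI_ex) blast
    then have "g - h \<in> I" by (simp add: coset_eq_iff cong_def)
    then have "\<epsilon> (g - h) \<in> I" using lin by (simp add: linear_mod_def)
    have "\<epsilon> ((g - h) + h) \<approx> \<epsilon> (g - h) + \<epsilon> h" using lin unfolding linear_mod_def by blast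
    also have "\<dots> \<approx> 0 + \<epsilon> h"
      using \<open>\<epsilon> (g - h) \<in> I\<close> by (intro cong_add cong_refl) (simp add: cong_zero_iff)
    finally have "coset (\<epsilon> g) = coset (\<epsilon> h)" by (simp add: coset_eq_iff)
    then show ?thesis by (simp add: \<delta>_def carrier_Q h_def)
  qed
  then have "lifts \<epsilon> \<delta>" by (simp add: lifts_def \<delta>_def)
  moreover from lifts_diff_ops_order[OF this] assms have "\<delta> \<in> diff_ops (coset ` C) Q"
    unfolding diff_ops_def by blast
  ultimately show thesis by (rule that)
qed

lemma diff_ops_lift:
  assumes "\<delta> \<in> diff_ops (coset ` C) Q"
  obtains n \<epsilon> where "lifts \<epsilon> \<delta>" "dop n \<epsilon>"
proof -
  from assms obtain n where n: "\<delta> \<in> diff_ops_order (coset ` C) Q n" by (auto simp: diff_ops_def)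
  then have "\<delta> \<in> carrier Q \<rightarrow>\<^sub>E carrier Q" by (cases n) (auto simp: hom_over_def)
  then have ext: "\<delta> \<in> extensional (carrier Q)" and "\<forall>g. \<exists>h. \<delta> (coset g) = coset h"
    by (auto simp: PiE_iff carrier_Q)
  then obtain \<epsilon> where "\<forall>g. \<delta> (coset g) = coset (\<epsilon> g)" by metis
  with ext have "lifts \<epsilon> \<delta>" by (simp add: lifts_def)
  with n lifts_diff_ops_order that show thesis by blast
qed

text \<open>Everything outside \<open>M\<close> is a unit. Hence if all operators send
  \<open>f\<close> into \<open>M\<close>, the orbit of \<open>f\<close> gives a nonzero stable ideal
  that misses 1; and if some operator sends \<open>f\<close> outside \<open>M\<close>, every stable
  ideal containing the coset of \<open>f\<close> contains 1.\<close>

lemma D_simple_iff: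
  assumes M: "type_ideal M" "I \<subseteq> M" "1 \<notin> M" "\<And>x. x \<notin> M \<Longrightarrow> \<exists>z. x * z = 1"
  shows "D_simple (coset ` C) Q \<longleftrightarrow> (\<forall>f. f \<notin> I \<longrightarrow> (\<exists>n \<delta>. dop n \<delta> \<and> \<delta> f \<notin> M))"
proof
  assume simple: "D_simple (coset ` C) Q"
  show "\<forall>f. f \<notin> I \<longrightarrow> (\<exists>n \<delta>. dop n \<delta> \<and> \<delta> f \<notin> M)"
  proof (intro allI impI, rule ccontr)
    fix f assume f: "f \<notin> I" and "\<not> (\<exists>n \<delta>. dop n \<delta> \<and> \<delta> f \<notin> M)"
    then have in_M: "\<delta> f \<in> M" if "dop n \<delta>" for n \<delta> using that by blast
    let ?J = "coset ` orbit f"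
    have "ideal ?J Q"
      by (rule ring.ring_ideal_imp_quot_ideal[OF ring_from_type_algebra ideal_J])
         (rule type_ideal.ideal_J[OF type_ideal_orbit])
    moreover have "\<delta> ` ?J \<subseteq> ?J" if \<delta>: "\<delta> \<in> diff_ops (coset ` C) Q" for \<delta>
    proof -
      obtain m \<epsilon> where \<epsilon>: "lifts \<epsilon> \<delta>" "dop m \<epsilon>" using \<delta> by (rule diff_ops_lift)
      show ?thesis
      proof
        fix U assume "U \<in> \<delta> ` ?J"
        then obtain n \<eta> where \<eta>: "dop n \<eta>" "U = \<delta> (coset (\<eta> f))"
          by (auto elim: orbitE)
        then have "U = coset (\<epsilon> (\<eta> f))" using \<epsilon>(1) by (simp add: lifts_def)
        moreover have "\<epsilon> (\<eta> f) \<in> orbit f" by (rule orbitI[OF dop_comp[OF \<epsilon>(2) \<eta>(1)]])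
        ultimately show "U \<in> ?J" by blast
      qed
    qed
    ultimately have "?J = {\<zero>\<^bsub>Q\<^esub>} \<or> ?J = carrier Q"
      by (intro simple[unfolded D_simple_def, THEN conjunct2, THEN spec, THEN mp] conjI ballI)
    then show False
    proof
      assume J: "?J = {\<zero>\<^bsub>Q\<^esub>}"
      have "coset f \<in> ?J" by (rule imageI) (rule orbitI[OF dop_id])
      with J have "coset f = coset 0" by (simp add: zero_Q)
      with f show False by (simp add: coset_eq_iff cong_zero_iff)
    next
      assume "?J = carrier Q"
      then have "coset 1 \<in> ?J" by (simp add: carrier_Q)
      then obtain n \<delta> where \<delta>: "dop n \<delta>" "coset 1 = coset (\<delta> f)" by (auto elim: orbitE)
      then have "1 - \<delta> f \<in> M" using M(2) by (auto simp: coset_eq_iff cong_def)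
      from type_ideal.add_closed[OF M(1) this in_M[OF \<delta>(1)]] M(3) show False by simp
    qed
  qed
next
  assume *: "\<forall>f. f \<notin> I \<longrightarrow> (\<exists>n \<delta>. dop n \<delta> \<and> \<delta> f \<notin> M)"
  show "D_simple (coset ` C) Q"
    unfolding D_simple_def
  proof (intro conjI allI impI)
    have "coset 1 \<noteq> coset 0" using M(2,3) by (auto simp: coset_eq_iff cong_def)
    moreover have "coset 1 \<in> carrier Q" unfolding carrier_Q by (rule rangeI)
    ultimately show "carrier Q \<noteq> {\<zero>\<^bsub>Q\<^esub>}" unfolding zero_Q by (metis singletonD)
  next
    fix J assume J: "ideal J Q \<and> (\<forall>\<delta>\<in>diff_ops (coset ` C) Q. \<delta> ` J \<subseteq> J)"
    note J_ideal = conjunct1[OF J]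
    show "J = {\<zero>\<^bsub>Q\<^esub>} \<or> J = carrier Q"
    proof (rule disjCI)
      assume "J \<noteq> carrier Q"
      show "J = {\<zero>\<^bsub>Q\<^esub>}"
      proof (rule ccontr)
        assume "J \<noteq> {\<zero>\<^bsub>Q\<^esub>}"
        then obtain U where U: "U \<in> J" "U \<noteq> \<zero>\<^bsub>Q\<^esub>"
          using additive_subgroup.zero_closed[OF ideal.axioms(1)[OF J_ideal]] by blast
        from U(1) have "U \<in> carrier Q" by (rule ideal.Icarr[OF J_ideal])
        then obtain f where f: "U = coset f" unfolding carrier_Q by blast
        with U(2) have "f \<notin> I" by (simp add: zero_Q coset_eq_iff cong_zero_iff)
        then obtain n \<epsilon> where \<epsilon>: "dop n \<epsilon>" "\<epsilon> f \<notin> M" using * by blast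
        obtain \<delta> where \<delta>: "lifts \<epsilon> \<delta>" "\<delta> \<in> diff_ops (coset ` C) Q" using \<epsilon>(1) by (rule dop_descends)
        have "\<delta> U \<in> J"
          by (rule subsetD[OF bspec[OF conjunct2[OF J] \<delta>(2)] imageI[OF U(1)]])
        then have "coset (\<epsilon> f) \<in> J" using \<delta>(1) by (simp add: lifts_def f)
        moreover obtain z where "\<epsilon> f * z = 1" using M(4) \<epsilon>(2) by blast
        ultimately have "\<one>\<^bsub>Q\<^esub> \<in> J"
          using ideal.I_r_closed[OF J_ideal, of "coset (\<epsilon> f)" "coset z"] by (simp add: mult_Q one_Q carrier_Q)
        then have "J = carrier Q" by (rule ideal.one_imp_carrier[OF J_ideal])
        with \<open>J \<noteq> carrier Q\<close> show False by blast
      qed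
    qed
  qed
qed

end


section \<open>Operators and elements of the tensor square\<close>

text \<open>The classical passage from endomorphisms over the ground field to functionals on P that
  are linear over one factor, here the right one.\<close>

definition op_functional ::
    "(('n, 'k::field) locpoly \<Rightarrow> ('n, 'k) locpoly) \<Rightarrow> ('n, 'k) locpoly2 \<Rightarrow> ('n, 'k) locpoly"
  where "op_functional \<delta> = tensor_lift (\<lambda>a b. b * \<delta> a)"

locale quotient_ops = lifted_ops I "range loc_const" for I :: "('n::finite, 'k::field) locpoly set"
begin

notation cong (infix "\<approx>" 50)

lemma bilinear_op:
  assumes "linear_mod (range loc_const) \<delta>"
  shows "bilinear_mod I (\<lambda>a b. b * \<delta> a)"
proof
  fix a a' b b' :: "('n, 'k) locpoly" and c
  have "b * \<delta> (a + a') \<approx> b * (\<delta> a + \<delta> a')"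
    using assms by (intro cong_mult cong_refl) (simp add: linear_mod_def)
  then show "b * \<delta> (a + a') \<approx> b * \<delta> a + b * \<delta> a'" by (simp only: distrib_left)
  show "(b + b') * \<delta> a \<approx> b * \<delta> a + b' * \<delta> a" by (simp add: distrib_right cong_refl)
  have "b * \<delta> (loc_const c * a) \<approx> b * (loc_const c * \<delta> a)"
    using assms by (intro cong_mult cong_refl) (simp add: linear_mod_def)
  then show "b * \<delta> (loc_const c * a) \<approx> loc_const c * b * \<delta> a" by (simp only: mult_ac)
qed

lemma op_functional_valued_in_ideal:
  assumes "\<And>x. \<delta> x \<in> I"
  shows "op_functional \<delta> w \<in> I"
  unfolding op_functional_def tensor_lift_def
  by (intro sum_closed mult_closed_left assms)

context
  fixes \<delta> assumes linear: "linear_mod (range loc_const) \<delta>"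
begin

interpretation F: bilinear_mod I "\<lambda>a b. b * \<delta> a"
  by (rule bilinear_op[OF linear])

lemma op_functional_tensor: "op_functional \<delta> (tensor a b) \<approx> b * \<delta> a"
  unfolding op_functional_def by (rule F.lift_tensor)

lemma op_functional_diff: "op_functional \<delta> (v - w) \<approx> op_functional \<delta> v - op_functional \<delta> w"
  unfolding op_functional_def by (rule F.lift_diff)

lemma op_functional_add: "op_functional \<delta> (v + w) \<approx> op_functional \<delta> v + op_functional \<delta> w"
  unfolding op_functional_def by (rule F.lift_add)

lemma op_functional_zero: "op_functional \<delta> 0 \<in> I"
  using F.lift_zero by (simp add: op_functional_def cong_zero_iff)

lemma op_functional_left: "op_functional \<delta> (left_incl a) \<approx> \<delta> a"
  using op_functional_tensor[of a 1] by (simp add: left_incl_def)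

lemma op_functional_right: "op_functional \<delta> (right_incl b * w) \<approx> b * op_functional \<delta> w"
proof (induction w rule: tensor_induct)
  case (tensor a b')
  have "op_functional \<delta> (right_incl b * tensor a b') \<approx> (b * b') * \<delta> a"
    using op_functional_tensor[of a "b * b'"] by (simp add: right_incl_def tensor_mult)
  also have "(b * b') * \<delta> a = b * (b' * \<delta> a)" by (rule mult.assoc)
  also have "\<dots> \<approx> b * op_functional \<delta> (tensor a b')"
    by (intro cong_mult cong_refl cong_sym[OF op_functional_tensor])
  finally show ?case .
next
  case (diff v w)
  have "op_functional \<delta> (right_incl b * (v - w)) \<approx>
      op_functional \<delta> (right_incl b * v) - op_functional \<delta> (right_incl b * w)"
    unfolding right_diff_distrib by (rule op_functional_diff)
  also have "\<dots> \<approx> b * op_functional \<delta> v - b * op_functional \<delta> w"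
    by (intro cong_diff diff)
  also have "\<dots> = b * (op_functional \<delta> v - op_functional \<delta> w)" by (simp only: right_diff_distrib)
  also have "\<dots> \<approx> b * op_functional \<delta> (v - w)"
    by (intro cong_mult cong_refl cong_sym[OF op_functional_diff])
  finally show ?case .
qed

text \<open>The kernel modulo \<open>I\<close> need not be an ideal of P. Testing all multiples
  gives the largest ideal inside it, and containment in that ideal can be checked on
  generators.\<close>

lemma type_ideal_functional_kernel: "type_ideal {w. \<forall>v. op_functional \<delta> (v * w) \<in> I}"
proof (rule type_ideal.intro, unfold ideal_ring_of_type_iff, intro conjI ballI allI)
  show "0 \<in> {w. \<forall>v. op_functional \<delta> (v * w) \<in> I}" by (simp add: op_functional_zero)
next
  fix x y assume "x \<in> {w. \<forall>v. op_functional \<delta> (v * w) \<in> I}" "y \<in> {w. \<forall>v. op_functional \<delta> (v * w) \<in> I}"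
  then show "x + y \<in> {w. \<forall>v. op_functional \<delta> (v * w) \<in> I}"
    by (simp add: distrib_left cong_mem_iff[OF op_functional_add] add_closed)
next
  fix x r assume "x \<in> {w. \<forall>v. op_functional \<delta> (v * w) \<in> I}"
  then show "r * x \<in> {w. \<forall>v. op_functional \<delta> (v * w) \<in> I}"
    by (simp add: mult.assoc[symmetric])
qed

lemma op_functional_left_ideal:
  assumes "i \<in> I"
  shows "op_functional \<delta> (v * left_incl i) \<in> I"
proof (induction v rule: tensor_induct)
  case (tensor a b)
  have "op_functional \<delta> (tensor a b * left_incl i) \<approx> b * \<delta> (a * i)"
    using op_functional_tensor[of "a * i" b] by (simp add: left_incl_def tensor_mult)
  moreover have "b * \<delta> (a * i) \<in> I"
    using linear by (intro mult_closed_left) (simp add: linear_mod_def mult_closed_left assms)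
  ultimately show ?case using cong_mem_iff by simp
next
  case (diff v w)
  then show ?case
    by (simp add: left_diff_distrib cong_mem_iff[OF op_functional_diff] diff_closed)
qed

end

text \<open>Taking the commutator with \<open>r\<close> is dual to multiplication by
  \<open>left_incl r - right_incl r\<close> on P; on a pure tensor this is bilinearity.\<close>

lemma op_functional_commutator:
  assumes lin: "linear_mod (range loc_const) \<delta>"
    and lin': "linear_mod (range loc_const) (\<lambda>x. \<delta> (r * x) - r * \<delta> x)"
  shows "op_functional \<delta> (w * (left_incl r - right_incl r)) \<approx> op_functional (\<lambda>x. \<delta> (r * x) - r * \<delta> x) w"
proof (induction w rule: tensor_induct)
  case (tensor a b)
  have "op_functional \<delta> (tensor a b * (left_incl r - right_incl r)) =
      op_functional \<delta> (tensor (r * a) b - tensor a (r * b))"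
    by (simp add: right_diff_distrib left_incl_def right_incl_def tensor_mult mult.commute)
  also have "\<dots> \<approx> op_functional \<delta> (tensor (r * a) b) - op_functional \<delta> (tensor a (r * b))"
    by (rule op_functional_diff[OF lin])
  also have "\<dots> \<approx> b * \<delta> (r * a) - (r * b) * \<delta> a"
    by (intro cong_diff op_functional_tensor[OF lin])
  also have "\<dots> = b * (\<delta> (r * a) - r * \<delta> a)" by (simp only: right_diff_distrib mult_ac)
  also have "\<dots> \<approx> op_functional (\<lambda>x. \<delta> (r * x) - r * \<delta> x) (tensor a b)"
    by (rule cong_sym[OF op_functional_tensor[OF lin']])
  finally show ?case .
next
  case (diff v w)
  have "op_functional \<delta> ((v - w) * (left_incl r - right_incl r)) \<approx>
      op_functional \<delta> (v * (left_incl r - right_incl r)) - op_functional \<delta> (w * (left_incl r - right_incl r))"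
    unfolding left_diff_distrib[of v w] by (rule op_functional_diff[OF lin])
  also have "\<dots> \<approx> op_functional (\<lambda>x. \<delta> (r * x) - r * \<delta> x) v - op_functional (\<lambda>x. \<delta> (r * x) - r * \<delta> x) w"
    by (intro cong_diff diff)
  also have "\<dots> \<approx> op_functional (\<lambda>x. \<delta> (r * x) - r * \<delta> x) (v - w)"
    by (rule cong_sym[OF op_functional_diff[OF lin']])
  finally show ?case .
qed

text \<open>Each factor passes to a commutator and lowers the order by one. After N factors the
  order is 0, and one more commutator has values in \<open>I\<close>; hence the exponent
  \<open>Suc N\<close>.\<close>

lemma op_functional_diag_power:
  "dop N \<delta> \<Longrightarrow> op_functional \<delta> (w * (left_incl r - right_incl r) ^ Suc N) \<in> I"
proof (induction N arbitrary: \<delta> w)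
  case 0
  have "op_functional (\<lambda>x. \<delta> (r * x) - r * \<delta> x) w \<in> I"
    by (rule op_functional_valued_in_ideal) (rule commutator_order_zero[OF 0])
  moreover have "linear_mod (range loc_const) (\<lambda>x. \<delta> (r * x) - r * \<delta> x)"
    by (rule linear_mod_valued_in_ideal) (rule commutator_order_zero[OF 0])
  ultimately show ?case
    using cong_mem_iff[OF op_functional_commutator[OF dop_linear[OF 0]]] by simp
next
  case (Suc N)
  have d: "dop N (\<lambda>x. \<delta> (r * x) - r * \<delta> x)" using Suc.prems by simp
  have "op_functional (\<lambda>x. \<delta> (r * x) - r * \<delta> x) (w * (left_incl r - right_incl r) ^ Suc N) \<in> I"
    by (rule Suc.IH[OF d])
  then have "op_functional \<delta> (w * (left_incl r - right_incl r) ^ Suc N * (left_incl r - right_incl r)) \<in> I"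
    using cong_mem_iff[OF op_functional_commutator[OF dop_linear[OF Suc.prems] dop_linear[OF d]]] by blast
  then show ?case by (simp add: mult_ac)
qed

lemma op_functional_diag_frob:
  assumes "dop N \<delta>" "w \<in> diag_frob (Suc N)"
  shows "op_functional \<delta> w \<in> I"
proof -
  have "diag_frob (Suc N) \<subseteq> {w. \<forall>v. op_functional \<delta> (v * w) \<in> I}"
    unfolding diag_frob_def
    by (rule ideal_gen_subset[OF type_ideal_functional_kernel[OF dop_linear[OF assms(1)]]])
       (use op_functional_diag_power[OF assms(1)] in blast)
  with assms(2) have "op_functional \<delta> (1 * w) \<in> I" by blast
  then show ?thesis by simp
qed

text \<open>An operator preserves \<open>I\<close>, so its functional sends
  \<open>ext_left I\<close> into \<open>I\<close>. For the representing element \<open>u\<close>,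
  nondegeneracy of the pairing translates this into membership in the colon ideal.\<close>

lemma dop_represented:
  assumes "dop N \<delta>"
  obtains u where
    "u \<in> ideal_colon (ideal_sum (ext_right I) (diag_frob (Suc N))) (ext_left I)"
    "\<And>g. top_coeff (Suc N) (u * left_incl g) \<approx> \<delta> g"
proof -
  note lin = dop_linear[OF assms]
  have I: "type_ideal I" by (rule type_ideal_axioms)
  obtain u where u: "\<And>w. top_coeff (Suc N) (u * w) \<approx> op_functional \<delta> w"
    using top_coeff_represents[OF zero_less_Suc I op_functional_add[OF lin] op_functional_right[OF lin]
        op_functional_diag_frob[OF assms]] by blast
  have "u \<in> ideal_colon (ideal_sum (ext_right I) (diag_frob (Suc N))) (ext_left I)"
    unfolding ideal_colon_def
  proof (intro CollectI ballI)
    fix h assume h: "h \<in> ext_left I"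
    have "ext_left I \<subseteq> {w. \<forall>v. op_functional \<delta> (v * w) \<in> I}"
      unfolding ext_left_def
      by (rule ideal_gen_subset[OF type_ideal_functional_kernel[OF lin]])
         (use op_functional_left_ideal[OF lin] in blast)
    with h have "op_functional \<delta> (v * h) \<in> I" for v by blast
    then have "op_functional \<delta> (h * v) \<in> I" for v by (simp only: mult.commute[of h v])
    then have "top_coeff (Suc N) (u * h * v) \<in> I" for v
      using cong_mem_iff[OF u[of "h * v"]] by (simp only: mult.assoc)
    then show "u * h \<in> ideal_sum (ext_right I) (diag_frob (Suc N))"
      by (rule mem_ext_right_of_top_coeff[OF zero_less_Suc])
  qed
  moreover have "top_coeff (Suc N) (u * left_incl g) \<approx> \<delta> g" for g
    by (rule cong_trans[OF u op_functional_left[OF lin]])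
  ultimately show thesis by (rule that)
qed

text \<open>The commutator with \<open>r\<close> multiplies \<open>u\<close> by \<open>r \<otimes> 1 - 1 \<otimes> r\<close>, hence raises its degree along the
  diagonal.\<close>

lemma dop_top_coeff_aux:
  assumes n: "n > 0"
  shows "u \<in> ideal_colon (ideal_sum (ext_right I) (diag_frob n)) (ext_left I) \<Longrightarrow>
    u - diag_eval q \<in> diag_frob n \<Longrightarrow> q \<in> degree_ge j \<Longrightarrow> card (UNIV :: 'n set) * n \<le> j + k \<Longrightarrow>
    dop k (\<lambda>g. top_coeff n (u * left_incl g))"
proof (induction k arbitrary: u q j)
  \<comment> \<open>No order is left, so the degree of \<open>q\<close> has reached d n. Then
    \<open>u\<close> lies in \<open>diag_frob n\<close> and the operator is zero.\<close>
  case 0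
  interpret D: type_ideal "diag_frob n :: ('n, 'k) locpoly2 set" by (rule type_ideal_diag_frob)
  from 0 have "q \<in> degree_ge (card (UNIV :: 'n set) * n)" by (auto simp: degree_ge_def)
  then have "diag_eval q \<in> diag_frob n"
    using degree_ge_subset_Y diag_eval_Y_ideal by blast
  with 0(2) have "u \<in> diag_frob n" using D.cong_mem_iff[of u "diag_eval q"] by (simp add: D.cong_def)
  then have "top_coeff n (u * left_incl g) = 0" for g
    by (intro top_coeff_diag_frob[OF n] D.mult_closed_right)
  then show ?case by (intro dop_valued_in_ideal) (simp add: zero_closed)
next
  case (Suc k)
  interpret D: type_ideal "diag_frob n :: ('n, 'k) locpoly2 set" by (rule type_ideal_diag_frob)
  let ?S = "ideal_sum (ext_right I) (diag_frob n)"
  have S: "type_ideal ?S" by (rule type_ideal_ideal_sum[OF type_ideal_ext_right type_ideal_diag_frob])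
  have "linear_mod (range loc_const) (\<lambda>g. top_coeff n (u * left_incl g))"
    unfolding linear_mod_def
  proof (intro conjI allI ballI)
    fix x y show "top_coeff n (u * left_incl (x + y)) \<approx> top_coeff n (u * left_incl x) + top_coeff n (u * left_incl y)"
      by (simp add: left_incl_add distrib_left top_coeff_add[OF n] cong_refl)
  next
    fix c x assume "c \<in> range (loc_const :: 'k \<Rightarrow> ('n, 'k) locpoly)"
    then have "left_incl c = right_incl c" by (auto simp: left_incl_loc_const)
    then have "u * left_incl (c * x) = right_incl c * (u * left_incl x)"
      by (simp add: left_incl_mult mult_ac)
    then show "top_coeff n (u * left_incl (c * x)) \<approx> c * top_coeff n (u * left_incl x)"
      by (simp add: top_coeff_right[OF n] cong_refl)
  next
    fix x assume "x \<in> I"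
    then have "u * left_incl x \<in> ?S"
      using Suc.prems(1) left_incl_in_ext_left by (auto simp: ideal_colon_def)
    then show "top_coeff n (u * left_incl x) \<in> I"
      by (rule top_coeff_ext_right[OF n type_ideal_axioms])
  qed
  moreover have "dop k (\<lambda>x. top_coeff n (u * left_incl (r * x)) - r * top_coeff n (u * left_incl x))" for r
  proof -
    let ?u = "u * (left_incl r - right_incl r)"
    \<comment> \<open>\<open>taylor n r - const r\<close> represents
      \<open>left_incl r - right_incl r\<close> and has no constant term, so the degree grows by
      one.\<close>
    let ?q = "q * (taylor n r - const r)"
    have "dop k (\<lambda>g. top_coeff n (?u * left_incl g))"
    proof (rule Suc.IH)
      show "?u \<in> ideal_colon ?S (ext_left I)"
        by (rule type_ideal.mult_closed_right[OF type_ideal_ideal_colon[OF S] Suc.prems(1)])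
      have "D.cong u (diag_eval q)" using Suc.prems(2) by (simp add: D.cong_def)
      moreover have "D.cong (left_incl r - right_incl r) (diag_eval (taylor n r) - right_incl r)"
        by (intro D.cong_diff D.cong_refl D.cong_sym[OF diag_eval_taylor])
      ultimately have "D.cong ?u (diag_eval q * (diag_eval (taylor n r) - right_incl r))"
        by (rule D.cong_mult)
      then show "?u - diag_eval ?q \<in> diag_frob n"
        by (simp add: D.cong_def diag_eval.eval_mult diag_eval.eval_diff diag_eval.eval_const)
      show "?q \<in> degree_ge (j + 1)"
        by (rule degree_ge_mult[OF Suc.prems(3) taylor_degree[OF n]])
      show "card (UNIV :: 'n set) * n \<le> j + 1 + k" using Suc.prems(4) by simp
    qed
    moreover have "top_coeff n (?u * left_incl x) = top_coeff n (u * left_incl (r * x)) - r * top_coeff n (u * left_incl x)" for x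
    proof -
      have "?u * left_incl x = u * left_incl (r * x) - right_incl r * (u * left_incl x)"
        by (simp only: left_incl_mult right_diff_distrib left_diff_distrib mult_ac)
      then show ?thesis by (simp only: top_coeff_diff[OF n] top_coeff_right[OF n])
    qed
    ultimately show ?thesis by simp
  qed
  ultimately show ?case by simp
qed

lemma dop_top_coeff:
  assumes "n > 0" "u \<in> ideal_colon (ideal_sum (ext_right I) (diag_frob n)) (ext_left I)"
  shows "dop (card (UNIV :: 'n set) * n) (\<lambda>g. top_coeff n (u * left_incl g))"
proof (rule dop_top_coeff_aux[OF assms _ degree_ge_zero])
  interpret D: type_ideal "diag_frob n :: ('n, 'k) locpoly2 set" by (rule type_ideal_diag_frob)
  show "u - diag_eval (tensor_taylor n u) \<in> diag_frob n"
    using D.cong_sym[OF diag_eval_tensor_taylor[of n u]] by (simp add: D.cong_def)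
qed simp

end

lemma frob_sum_eq:
  "ideal_sum (ext_left (frob_ideal n)) (ext_right max_ideal) =
    ideal_sum (ext_right (max_ideal :: ('n::finite, 'k::field) locpoly set)) (diag_frob n)"
  (is "?L = ?R")
proof -
  have L: "type_ideal ?L" by (intro type_ideal_ideal_sum type_ideal_ext_left type_ideal_ext_right)
  have R: "type_ideal ?R" by (intro type_ideal_ideal_sum type_ideal_diag_frob type_ideal_ext_right)
  interpret L: type_ideal ?L by (rule L)
  interpret R: type_ideal ?R by (rule R)
  have pow: "left_incl (loc_var i) ^ n - diag_var i ^ n \<in> ext_right (max_ideal :: ('n, 'k) locpoly set)" for i
  proof -
    have "loc_var i \<in> (max_ideal :: ('n, 'k) locpoly set)"
      unfolding mem_max_ideal_iff loc_var_def loc_eval_loc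
      by (simp add: mvar_def lookup_single when_def poly_mapping_eq_iff fun_eq_iff)
    then have x: "right_incl (loc_var i) \<in> ext_right (max_ideal :: ('n, 'k) locpoly set)"
      by (rule right_incl_in_ext_right)
    have "left_incl (loc_var i) - diag_var i = (right_incl (loc_var i) :: ('n, 'k) locpoly2)"
      by (simp add: diag_var_def)
    then show ?thesis
      \<comment> \<open>A difference of n-th powers is a multiple of the difference of the bases,
        which here is \<open>right_incl (loc_var i)\<close>.\<close>
      unfolding power_diff_sumr2
      by (simp only:) (rule type_ideal.mult_closed_right[OF type_ideal_ext_right x])
  qed
  have "diag_frob n \<subseteq> ?L"
    unfolding diag_frob_eq
  proof (rule ideal_gen_subset[OF L], rule image_subsetI)
    fix i :: 'n
    have "left_incl (loc_var i ^ n) \<in> ext_left (frob_ideal n :: ('n, 'k) locpoly set)"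
      unfolding frob_ideal_def by (rule left_incl_in_ext_left[OF subsetD[OF ideal_gen_superset rangeI]])
    then have "left_incl (loc_var i) ^ n \<in> ?L"
      by (intro ideal_sum_left type_ideal_ext_right) (simp add: left_incl_power)
    moreover have "left_incl (loc_var i) ^ n - diag_var i ^ n \<in> ?L"
      by (intro ideal_sum_right type_ideal_ext_left pow)
    ultimately show "diag_var i ^ n \<in> ?L"
      using L.cong_mem_iff[of "left_incl (loc_var i) ^ n" "diag_var i ^ n"] by (simp add: L.cong_def)
  qed
  moreover have "ext_right max_ideal \<subseteq> ?L" by (rule subsetI) (rule ideal_sum_right[OF type_ideal_ext_left])
  ultimately have "?R \<subseteq> ?L" by (intro ideal_sum_minimal[OF L])
  moreover have "?L \<subseteq> ?R"
  proof (rule ideal_sum_minimal[OF R])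
    show "ext_right max_ideal \<subseteq> ?R" by (rule subsetI) (rule ideal_sum_left[OF type_ideal_diag_frob])
    have "type_ideal {g. left_incl g \<in> ?R}"
      by (rule type_ideal.intro)
         (simp add: ideal_ring_of_type_iff left_incl_zero left_incl_add left_incl_mult
           R.zero_closed R.add_closed R.mult_closed_left)
    then have "frob_ideal n \<subseteq> {g. left_incl g \<in> ?R}"
      unfolding frob_ideal_def
    proof (rule ideal_gen_subset, intro image_subsetI CollectI)
      fix i :: 'n
      have "diag_var i ^ n \<in> ?R"
        unfolding diag_frob_eq
        by (rule ideal_sum_right[OF type_ideal_ext_right subsetD[OF ideal_gen_superset rangeI]])
      moreover have "left_incl (loc_var i) ^ n - diag_var i ^ n \<in> ?R"
        by (intro ideal_sum_left type_ideal_diag_frob pow)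
      ultimately show "left_incl (loc_var i ^ n) \<in> ?R"
        using R.cong_mem_iff[of "left_incl (loc_var i) ^ n" "diag_var i ^ n"]
        by (simp add: R.cong_def left_incl_power)
    qed
    then show "ext_left (frob_ideal n) \<subseteq> ?R"
      unfolding ext_left_def
      by (intro ideal_gen_subset[OF R] image_subsetI) (simp only: subset_iff mem_Collect_eq)
  qed
  ultimately show ?thesis by (rule subset_antisym[rotated])
qed

theorem theorem3p21:
  fixes I :: "('n::finite, 'k::field) locpoly set"
  assumes "ideal I loc_ring" and "I \<noteq> carrier loc_ring"
  shows "D_simple (quot_scalars I) (loc_ring Quot I) \<longleftrightarrow>
    (\<forall>f. I +>\<^bsub>loc_ring\<^esub> f \<noteq> \<zero>\<^bsub>loc_ring Quot I\<^esub> \<longrightarrow>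
      (\<exists>n. \<not> (\<lambda>u. left_incl f * u) `
              ideal_colon (ideal_sum (ext_right I) (diag_frob n)) (ext_left I)
            \<subseteq> ideal_sum (ext_left (frob_ideal n)) (ext_right max_ideal)))"
proof -
  interpret quotient_ops I
    by (intro quotient_ops.intro lifted_ops.intro type_ideal.intro assms(1))
  have one: "1 \<notin> I"
  proof
    assume "1 \<in> I"
    then have "x \<in> I" for x using mult_closed_left[of 1 x] by simp
    with assms(2) show False by (auto simp: ring_of_type_algebra_def)
  qed
  have I_max: "I \<subseteq> max_ideal" by (rule type_ideal_proper_subset_max[OF type_ideal_axioms one])
  have one_max: "1 \<notin> (max_ideal :: ('n, 'k) locpoly set)"
    by (simp add: mem_max_ideal_iff loc_eval_simps)
  have unit: "\<exists>z. x * z = 1" if "x \<notin> max_ideal" for x :: "('n, 'k) locpoly"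
    using that loc_eval_nonzero_unit by (metis mem_max_ideal_iff)
  have scalars: "quot_scalars I = coset ` range loc_const"
    unfolding quot_scalars_def by (rule image_image[symmetric])
  have nonzero: "coset f \<noteq> \<zero>\<^bsub>loc_ring Quot I\<^esub> \<longleftrightarrow> f \<notin> I" for f
    by (simp add: zero_Q coset_eq_iff cong_zero_iff)
  have eq: "(\<exists>N \<delta>. dop N \<delta> \<and> \<delta> f \<notin> max_ideal) \<longleftrightarrow>
      (\<exists>n. \<not> (\<lambda>u. left_incl f * u) `
              ideal_colon (ideal_sum (ext_right I) (diag_frob n)) (ext_left I)
            \<subseteq> ideal_sum (ext_left (frob_ideal n)) (ext_right max_ideal))" (is "?A \<longleftrightarrow> ?B") for f
  proof
    assume ?A
    then obtain N \<delta> where \<delta>: "dop N \<delta>" "\<delta> f \<notin> max_ideal" by (elim exE conjE)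
    obtain u where u: "u \<in> ideal_colon (ideal_sum (ext_right I) (diag_frob (Suc N))) (ext_left I)"
      and repr: "\<And>g. cong (top_coeff (Suc N) (u * left_incl g)) (\<delta> g)"
      using dop_represented[OF \<delta>(1)] by metis
    have "left_incl f * u \<notin> ideal_sum (ext_left (frob_ideal (Suc N))) (ext_right max_ideal)"
    proof
      assume "left_incl f * u \<in> ideal_sum (ext_left (frob_ideal (Suc N))) (ext_right max_ideal)"
      then have "top_coeff (Suc N) (left_incl f * u) \<in> max_ideal"
        unfolding frob_sum_eq by (rule top_coeff_ext_right[OF zero_less_Suc type_ideal_max_ideal])
      \<comment> \<open>\<open>u\<close> represents \<open>\<delta>\<close> only modulo
        \<open>I\<close>; this is enough because \<open>I\<close> lies in
        \<open>max_ideal\<close>.\<close>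
      moreover have "top_coeff (Suc N) (left_incl f * u) - \<delta> f \<in> max_ideal"
        using repr[of f] I_max by (auto simp: cong_def mult.commute)
      ultimately have "\<delta> f \<in> max_ideal"
        using type_ideal.diff_closed[OF type_ideal_max_ideal] by fastforce
      with \<delta>(2) show False by contradiction
    qed
    with u show ?B by (intro exI[of _ "Suc N"]) (simp only: image_subset_iff, blast)
  next
    assume ?B
    then obtain n u where u: "u \<in> ideal_colon (ideal_sum (ext_right I) (diag_frob n)) (ext_left I)"
      and notin: "left_incl f * u \<notin> ideal_sum (ext_right max_ideal) (diag_frob n)"
      unfolding frob_sum_eq by (auto simp only: image_subset_iff)
    \<comment> \<open>At level 0 the generators of \<open>diag_frob 0\<close> are zeroth powers, so
      it is all of P and nothing lies outside the sum.\<close>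
    have n: "n > 0"
    proof (rule ccontr)
      assume "\<not> n > 0"
      then have "1 \<in> (diag_frob n :: ('n, 'k) locpoly2 set)"
        unfolding diag_frob_def using ideal_gen_superset by fastforce
      then have "left_incl f * u * 1 \<in> diag_frob n"
        by (rule type_ideal.mult_closed_left[OF type_ideal_diag_frob])
      with notin ideal_sum_right[OF type_ideal_ext_right] show False by fastforce
    qed
    \<comment> \<open>Nondegeneracy of the pairing, now with coefficients modulo
      \<open>max_ideal\<close>, provides the multiple of \<open>u\<close> whose operator sends
      \<open>f\<close> to a unit.\<close>
    obtain v where v: "top_coeff n (left_incl f * u * v) \<notin> max_ideal"
      using notin mem_ext_right_of_top_coeff[OF n] by metis
    have "u * v \<in> ideal_colon (ideal_sum (ext_right I) (diag_frob n)) (ext_left I)"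
      by (rule type_ideal.mult_closed_right[OF type_ideal_ideal_colon u])
         (intro type_ideal_ideal_sum type_ideal_ext_right type_ideal_diag_frob)
    from dop_top_coeff[OF n this]
    have "dop (card (UNIV :: 'n set) * n) (\<lambda>g. top_coeff n (u * v * left_incl g))" .
    moreover have "top_coeff n (u * v * left_incl f) \<notin> max_ideal" using v by (simp add: mult_ac)
    ultimately show ?A by (intro exI conjI)
  qed
  show ?thesis
    unfolding scalars nonzero eq[symmetric]
    by (rule D_simple_iff[OF type_ideal_max_ideal I_max one_max unit])
qed

end
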